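(* Let $n\ge 1$, let $\lambda,\mu\in\mathbb{R}$, put $\delta=\mu-\lambda$, and assume $\delta\neq 1+\frac{\ell}{n+1}$ for all $\ell=0,1,2,\ldots$. Then the projectively (i.e. $\mathrm{SL}(n+1,\mathbb{R})$-) equivariant quantization map $\mathcal{Q}_{\lambda,\mu}:\mathcal{S}_\delta(S^n)\to\mathcal{D}_{\lambda,\mu}(S^n)$ is, in any affine coordinate system and with $\mathcal{D}_{\lambda,\mu}$ identified with $\mathcal{S}_\delta$ by the normal ordering $\mathcal{I}$, of the form $$ \mathcal{Q}_{\lambda,\mu}=F\left(\left.\begin{array}{c}A_1,A_2\\ B_1,B_2\end{array}\right|Z\right) =\sum_{m=0}^\infty \frac{(A_1)_m(A_2)_m}{(B_1)_m(B_2)_m}\,\frac{Z^m}{m!}, $$ where the parameters are the operators $$ A_1=\mathcal{E}+(n+1)\lambda,\qquad A_2=2\mathcal{E}+(n+1)(1-\delta)-1, $$ $$ B_1=\mathcal{E}+\tfrac12(n+1)(1-\delta)-\tfrac12,\qquad B_2=\mathcal{E}+\tfrac12(n+1)(1-\delta), $$ and the variable is the operator $Z=\dfrac{i\hbar\,\mathrm{D}}{4}$, the powers of $\mathrm{D}$ being placed to the right of the coefficients depending on $\mathcal{E}$.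
   Context: $S^n$ carries its standard $\mathrm{SL}(n+1,\mathbb{R})$-action (on rays of $\mathbb{R}^{n+1}$) and the affine coordinate systems $(x^i)$ of the corresponding flat projective structure; in these, the Lie algebra $\mathrm{sl}(n+1,\mathbb{R})$ acts by the span of $\partial/\partial x^i$, $x^i\partial/\partial x^j$, $x^ix^j\partial/\partial x^j$ (summation over repeated indices). $\hbar>0$ is a fixed constant. $\mathcal{F}_\lambda(S^n)$ is the space of complex-valued tensor densities of degree $\lambda$, and $\mathcal{D}_{\lambda,\mu}(S^n)$ is the space of linear differential operators $\mathcal{F}_\lambda(S^n)\to\mathcal{F}_\mu(S^n)$. With $\delta=\mu-\lambda$, $\mathcal{S}_\delta=\mathcal{S}(S^n)\otimes\mathcal{F}_\delta(S^n)$, where $\mathcal{S}(S^n)$ is the space of smooth functions on $T^*S^n$ polynomial on the fibers; $\mathcal{S}_\delta=\bigoplus_{k\ge0}\mathcal{S}_{k,\delta}$ is graded by the degree of polynomials. Let $\xi_i$ be the fiber coordinates dual to $x^i$. Normal ordering: $\mathcal{I}\big(P(x)^{i_1\ldots i_k}\xi_{i_1}\cdots\xi_{i_k}\big)=(i\hbar)^kP(x)^{i_1\ldots i_k}\frac{\partial}{\partial x^{i_1}}\cdots\frac{\partial}{\partial x^{i_k}}$; it is used in each affine chart to identify $\mathcal{S}_\delta$ and $\mathcal{D}_{\lambda,\mu}$. Operators on symbols: $\mathcal{E}=\xi_i\frac{\partial}{\partial\xi_i}$ (degree operator) and $\mathrm{D}=\frac{\partial}{\partial x^i}\frac{\partial}{\partial\xi_i}$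 (divergence operator, lowering degree by one). The projectively equivariant quantization map $\mathcal{Q}_{\lambda,\mu}:\mathcal{S}_\delta\to\mathcal{D}_{\lambda,\mu}$ is the linear isomorphism commuting with the $\mathrm{SL}(n+1,\mathbb{R})$-action and preserving principal symbols (under $\mathcal{I}$). It is known, and taken as given, that in affine coordinates (with the identification $\mathcal{I}$) it is $$\mathcal{Q}_{\lambda,\mu}\big|_{\mathcal{S}_{k,\delta}}=\sum_{m=0}^kC_m^k\,(i\hbar\mathrm{D})^m\big|_{\mathcal{S}_{k,\delta}},\qquad C_0^k=1,\qquad C_{m+1}^k=\frac{k-m-1+(n+1)\lambda}{(m+1)(2k-m-2+(n+1)(1-\delta))}\,C_m^k .$$ Notation: $(a)_m=a(a+1)\cdots(a+m-1)$, $(a)_0=1$. A coefficient depending on $\mathcal{E}$ acts on a homogeneous symbol of degree $j$ by substituting $\mathcal{E}=j$. If a quotient $(A_2)_m/((B_1)_m(B_2)_m)$ takes the form $0/0$ at some degree (this happens only for $(n+1)(1-\delta)=1$, at degree $0$), it is understood after cancellation of the common factor in $A_2=2B_1$. *)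

theory Defs
  imports "HOL-Analysis.Analysis"
begin

section \<open>Iterated partial derivatives and smooth functions\<close>

definition pd :: "'n::finite \<Rightarrow> (real^'n \<Rightarrow> complex) \<Rightarrow> real^'n \<Rightarrow> complex"
  where "pd i f x = vector_derivative (\<lambda>t. f (x + t *\<^sub>R axis i 1)) (at 0)"

definition pds :: "'n::finite list \<Rightarrow> (real^'n \<Rightarrow> complex) \<Rightarrow> real^'n \<Rightarrow> complex"
  where "pds is f = foldr pd is f"

definition smooth :: "(real^'n::finite \<Rightarrow> complex) \<Rightarrow> bool"
  where "smooth f \<longleftrightarrow> (\<forall>is x. pds is f differentiable (at x))"


section \<open>The sphere of rays and its affine coordinate systems\<close>

text \<open>
  With \<open>n = CARD('n)\<close>, the space \<open>real^('n option)\<close> is the (n+1)-dimensional linear space, the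
  index \<open>None\<close> playing the role of the homogeneous coordinate 0.  A ray is represented by its unit
  vector.  An invertible matrix \<open>A\<close> (a linear frame) determines an affine coordinate system on an
  open hemisphere: \<open>x\<^sup>j = X\<^sup>j / X\<^sup>0\<close> for \<open>X = A\<^sup>-\<^sup>1 u\<close>, on the set where \<open>X\<^sup>0 > 0\<close>.
\<close>

definition affine_lift :: "real^'n::finite \<Rightarrow> real^('n option)"
  where "affine_lift x = (\<chi> j. case j of None \<Rightarrow> 1 | Some i \<Rightarrow> x $ i)"

definition affine_param :: "real^('n::finite option)^('n option) \<Rightarrow> real^'n \<Rightarrow> real^('n option)"
  where "affine_param A x = (A *v affine_lift x) /\<^sub>R norm (A *v affine_lift x)"

definition affine_dom :: "real^('n::finite option)^('n option) \<Rightarrow> (real^('n option)) set"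
  where "affine_dom A = {u \<in> sphere 0 1. (matrix_inv A *v u) $ None > 0}"

definition affine_coords :: "real^('n::finite option)^('n option) \<Rightarrow> real^('n option) \<Rightarrow> real^'n"
  where "affine_coords A u = (\<chi> i. (matrix_inv A *v u) $ Some i / (matrix_inv A *v u) $ None)"

definition transition ::
  "real^('n::finite option)^('n option) \<Rightarrow> real^('n option)^('n option) \<Rightarrow> real^'n \<Rightarrow> real^'n"
  where "transition A B x = affine_coords B (affine_param A x)"


section \<open>Tensor densities and symbols\<close>

text \<open>
  A geometric object on the sphere is the family of its expressions in all affine coordinate
  systems, subject to the transformation law of its type on overlaps.  Since the affine coordinate
  domains cover the sphere, these families are exactly the global smooth sections.  The value at a
  matrix that is not a frame is normalised to 0, so that equality of families is equality of
  sections.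
\<close>

type_synonym 'n density = "real^('n option)^('n option) \<Rightarrow> real^'n \<Rightarrow> complex"
type_synonym 'n symbol = "real^('n option)^('n option) \<Rightarrow> real^'n \<Rightarrow> real^'n \<Rightarrow> complex"

definition densities :: "real \<Rightarrow> ('n::finite) density set"
  where "densities lam = {\<phi>.
     (\<forall>A. \<not> invertible A \<longrightarrow> \<phi> A = (\<lambda>x. 0)) \<and>
     (\<forall>A. invertible A \<longrightarrow> smooth (\<phi> A)) \<and>
     (\<forall>A B x. invertible A \<longrightarrow> invertible B \<longrightarrow> affine_param A x \<in> affine_dom B \<longrightarrow>
        \<phi> A x = of_real (\<bar>det (jacobian (transition A B) (at x))\<bar> powr lam)
                * \<phi> B (transition A B x))}"

text \<open>
  Coordinate expressions \<open>p x \<xi>\<close> of symbols: \<open>p x \<xi> = P(x)\<^sup>i\<^sup>1\<^sup>.\<^sup>.\<^sup>.\<^sup>i\<^sup>k \<xi>\<^sub>i\<^sub>1 ... \<xi>\<^sub>i\<^sub>k\<close>, where the list \<open>is\<close>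
  is \<open>[i\<^sub>1, ..., i\<^sub>k]\<close>.
\<close>

definition homogeneous_poly :: "nat \<Rightarrow> (real^'n::finite \<Rightarrow> real^'n \<Rightarrow> complex) set"
  where "homogeneous_poly k = {p. \<exists>P :: 'n list \<Rightarrow> real^'n \<Rightarrow> complex. (\<forall>is. smooth (P is)) \<and>
     p = (\<lambda>x \<xi>. \<Sum>is | length is = k. P is x * of_real (\<Prod>i\<leftarrow>is. \<xi> $ i))}"

definition fibre_poly :: "(real^'n::finite \<Rightarrow> real^'n \<Rightarrow> complex) set"
  where "fibre_poly = {p. \<exists>N h. (\<forall>k. h k \<in> homogeneous_poly k) \<and> p = (\<lambda>x \<xi>. \<Sum>k\<le>N. h k x \<xi>)}"

text \<open>
  The fibre coordinates transform as covectors: \<open>\<xi>\<^sub>i = (\<partial>y\<^sup>j/\<partial>x\<^sup>i) \<eta>\<^sub>j\<close> for the coordinate change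
  \<open>y = transition A B x\<close>.
\<close>

definition symbols :: "real \<Rightarrow> ('n::finite) symbol set"
  where "symbols \<delta> = {P.
     (\<forall>A. \<not> invertible A \<longrightarrow> P A = (\<lambda>x \<xi>. 0)) \<and>
     (\<forall>A. invertible A \<longrightarrow> P A \<in> fibre_poly) \<and>
     (\<forall>A B x \<eta>. invertible A \<longrightarrow> invertible B \<longrightarrow> affine_param A x \<in> affine_dom B \<longrightarrow>
        P A x (transpose (jacobian (transition A B) (at x)) *v \<eta>)
        = of_real (\<bar>det (jacobian (transition A B) (at x))\<bar> powr \<delta>)
          * P B (transition A B x) \<eta>)}"

definition homogeneous_symbols :: "nat \<Rightarrow> real \<Rightarrow> ('n::finite) symbol set"
  where "homogeneous_symbols k \<delta> =
     {P \<in> symbols \<delta>. \<forall>A. invertible A \<longrightarrow> P A \<in> homogeneous_poly k}"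


section \<open>Normal ordering and differential operators\<close>

text \<open>
  The symmetric coefficients \<open>P(x)\<^sup>i\<^sup>1\<^sup>.\<^sup>.\<^sup>.\<^sup>i\<^sup>k\<close> of a fibrewise polynomial function are its Taylor
  coefficients in the fibre variable at 0 (see \<open>fibre_coeff_sum\<close> below).  For a fibrewise
  polynomial function only finitely many of them are nonzero, so the sum in
  \<open>normal_ordering\<close> is finite.
\<close>

definition fibre_coeff ::
  "(real^'n::finite \<Rightarrow> real^'n \<Rightarrow> complex) \<Rightarrow> 'n list \<Rightarrow> real^'n \<Rightarrow> complex"
  where "fibre_coeff p is x = pds is (p x) 0 / fact (length is)"

definition tensor_poly :: "nat \<Rightarrow> ('n::finite list \<Rightarrow> complex) \<Rightarrow> real^'n \<Rightarrow> complex"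
  where "tensor_poly k c \<xi> = (\<Sum>is | length is = k. c is * of_real (\<Prod>i\<leftarrow>is. \<xi> $ i))"

lemma tensor_poly_0 [simp]: "tensor_poly 0 c = (\<lambda>\<xi>. c [])"
  by (rule ext) (simp add: tensor_poly_def)

lemma tensor_poly_Suc:
  "tensor_poly (Suc k) c \<xi> = (\<Sum>i\<in>UNIV. of_real (\<xi> $ i) * tensor_poly k (\<lambda>is. c (i # is)) \<xi>)"
proof -
  have "tensor_poly (Suc k) c \<xi>
      = (\<Sum>(i, is)\<in>UNIV \<times> {is. length is = k}. c (i # is) * of_real (\<Prod>j\<leftarrow>i # is. \<xi> $ j))"
    unfolding tensor_poly_def
    by (rule sum.reindex_bij_witness[of _ "\<lambda>(i, is). i # is" "\<lambda>is. (hd is, tl is)"])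
      (auto simp: length_Suc_conv)
  also have "\<dots> = (\<Sum>i\<in>UNIV. of_real (\<xi> $ i) * tensor_poly k (\<lambda>is. c (i # is)) \<xi>)"
    by (simp add: sum.cartesian_product[symmetric] tensor_poly_def sum_distrib_left mult_ac)
  finally show ?thesis .
qed

lemma has_vector_derivative_tensor_poly:
  assumes "\<And>is js. mset is = mset js \<Longrightarrow> c is = c js"
  shows "((\<lambda>t. tensor_poly k c (\<xi> + t *\<^sub>R axis j 1)) has_vector_derivative
           of_nat k * tensor_poly (k - 1) (\<lambda>is. c (j # is)) \<xi>) (at 0)"
  using assms
proof (induction k arbitrary: c)
  case 0
  show ?case by simp
next
  case (Suc k)
  have IH: "((\<lambda>t. tensor_poly k (\<lambda>is. c (i # is)) (\<xi> + t *\<^sub>R axis j 1)) has_vector_derivative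
      of_nat k * tensor_poly (k - 1) (\<lambda>is. c (i # j # is)) \<xi>) (at 0)" for i
    by (rule Suc.IH) (auto intro: Suc.prems)
  have co: "((\<lambda>t. of_real ((\<xi> + t *\<^sub>R axis j 1) $ i) :: complex) has_vector_derivative
      (if i = j then 1 else 0)) (at 0)" for i
  proof -
    have "((\<lambda>t. of_real (\<xi> $ i) + t *\<^sub>R of_real (axis j 1 $ i) :: complex) has_vector_derivative
        of_real (axis j 1 $ i)) (at 0)"
      by (auto intro!: derivative_eq_intros)
    moreover have "of_real ((\<xi> + t *\<^sub>R axis j 1) $ i)
        = (of_real (\<xi> $ i) + t *\<^sub>R of_real (axis j 1 $ i) :: complex)" for t
      by (simp only: vector_add_component vector_scaleR_component of_real_add)
        (simp add: scaleR_conv_of_real)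
    moreover have "(of_real (axis j 1 $ i) :: complex) = (if i = j then 1 else 0)"
      by (simp add: axis_def)
    ultimately show ?thesis by (simp only:)
  qed
  have "((\<lambda>t. tensor_poly (Suc k) c (\<xi> + t *\<^sub>R axis j 1)) has_vector_derivative
      (\<Sum>i\<in>UNIV. of_real ((\<xi> + 0 *\<^sub>R axis j 1) $ i) * (of_nat k * tensor_poly (k - 1) (\<lambda>is. c (i # j # is)) \<xi>)
        + (if i = j then 1 else 0) * tensor_poly k (\<lambda>is. c (i # is)) (\<xi> + 0 *\<^sub>R axis j 1))) (at 0)"
    unfolding tensor_poly_Suc
    by (intro has_vector_derivative_sum has_vector_derivative_mult co IH)
  also have "(\<Sum>i\<in>UNIV. of_real ((\<xi> + 0 *\<^sub>R axis j 1) $ i) * (of_nat k * tensor_poly (k - 1) (\<lambda>is. c (i # j # is)) \<xi>)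
        + (if i = j then 1 else 0) * tensor_poly k (\<lambda>is. c (i # is)) (\<xi> + 0 *\<^sub>R axis j 1))
      = of_nat k * (\<Sum>i\<in>UNIV. of_real (\<xi> $ i) * tensor_poly (k - 1) (\<lambda>is. c (j # i # is)) \<xi>)
        + tensor_poly k (\<lambda>is. c (j # is)) \<xi>"
  proof -
    have sw: "c (i # j # is) = c (j # i # is)" for i "is"
      by (rule Suc.prems) simp
    have "(if i = j then 1 else 0) * z = (if i = j then z else 0)" for i and z :: complex
      by simp
    then show ?thesis
      unfolding sw by (simp add: sum.distrib sum_distrib_left mult.left_commute)
  qed
  also have "of_nat k * (\<Sum>i\<in>UNIV. of_real (\<xi> $ i) * tensor_poly (k - 1) (\<lambda>is. c (j # i # is)) \<xi>)
      = of_nat k * tensor_poly k (\<lambda>is. c (j # is)) \<xi>"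
    by (cases k) (simp_all add: tensor_poly_Suc)
  finally show ?case by (simp add: algebra_simps)
qed

lemma pd_tensor_poly:
  assumes "\<And>is js. mset is = mset js \<Longrightarrow> c is = c js"
  shows "pd j (\<lambda>\<xi>. a * tensor_poly k c \<xi>)
           = (\<lambda>\<xi>. a * of_nat k * tensor_poly (k - 1) (\<lambda>is. c (j # is)) \<xi>)"
  unfolding pd_def mult.assoc
  by (intro ext vector_derivative_at has_vector_derivative_mult_right
        has_vector_derivative_tensor_poly assms)

lemma pds_tensor_poly:
  assumes sym: "\<And>is js. mset is = mset js \<Longrightarrow> c is = c js"
  shows "pds js (tensor_poly k c) = (\<lambda>\<xi>. if length js \<le> k
           then fact k / fact (k - length js) * tensor_poly (k - length js) (\<lambda>is. c (js @ is)) \<xi>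
           else 0)"
proof (induction js)
  case Nil
  then show ?case by (simp add: pds_def)
next
  case (Cons j js)
  have c: "c (js @ j # is) = c (j # js @ is)" for "is" by (rule sym) simp
  have eq: "pds (j # js) (tensor_poly k c) = pd j (pds js (tensor_poly k c))"
    by (simp add: pds_def)
  consider "length js < k" | "length js = k" | "length js > k" by linarith
  then show ?case
  proof cases
    case 1
    then obtain r where r: "k - length js = Suc r" by (metis Suc_diff_Suc)
    have "pd j (pds js (tensor_poly k c))
        = pd j (\<lambda>\<xi>. fact k / fact (Suc r) * tensor_poly (Suc r) (\<lambda>is. c (js @ is)) \<xi>)"
      using 1 r by (simp add: Cons.IH del: fact_Suc)
    also have "\<dots> = (\<lambda>\<xi>. fact k / fact (Suc r) * of_nat (Suc r)
        * tensor_poly (Suc r - 1) (\<lambda>is. c (js @ j # is)) \<xi>)"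
      by (rule pd_tensor_poly) (auto intro: sym)
    also have "\<dots> = (\<lambda>\<xi>. fact k / fact r * tensor_poly r (\<lambda>is. c (j # js @ is)) \<xi>)"
      by (simp add: c del: of_nat_Suc)
    finally have "pds (j # js) (tensor_poly k c)
        = (\<lambda>\<xi>. fact k / fact r * tensor_poly r (\<lambda>is. c (j # js @ is)) \<xi>)"
      unfolding eq .
    moreover have "k - length (j # js) = r" "length (j # js) \<le> k" using 1 r by auto
    ultimately show ?thesis by (simp only: if_True append_Cons)
  next
    case 2
    then show ?thesis by (simp add: eq Cons.IH) (simp add: pd_def fun_eq_iff)
  next
    case 3
    then show ?thesis by (simp add: eq Cons.IH) (simp add: pd_def fun_eq_iff)
  qed
qed

lemma fibre_coeff_sum:
  fixes P :: "'n::finite list \<Rightarrow> real^'n \<Rightarrow> complex"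
  assumes "\<And>is js. mset is = mset js \<Longrightarrow> P is = P js"
  shows "fibre_coeff (\<lambda>x \<xi>. \<Sum>is | length is = k. P is x * of_real (\<Prod>i\<leftarrow>is. \<xi> $ i)) js x
           = (if length js = k then P js x else 0)"
proof -
  have "tensor_poly r c 0 = (if r = 0 then c [] else 0)" for r and c :: "'n list \<Rightarrow> complex"
    by (cases r) (simp_all add: tensor_poly_Suc)
  moreover have "pds js (tensor_poly k (\<lambda>is. P is x)) = (\<lambda>\<xi>. if length js \<le> k
           then fact k / fact (k - length js)
                * tensor_poly (k - length js) (\<lambda>is. P (js @ is) x) \<xi>
           else 0)"
    by (rule pds_tensor_poly) (rule arg_cong[OF assms, of _ _ "\<lambda>f. f x"])
  ultimately show ?thesis
    unfolding fibre_coeff_def tensor_poly_def[symmetric] by auto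
qed

definition normal_ordering ::
  "real \<Rightarrow> (real^'n::finite \<Rightarrow> real^'n \<Rightarrow> complex) \<Rightarrow> (real^'n \<Rightarrow> complex) \<Rightarrow> real^'n \<Rightarrow> complex"
  where "normal_ordering hbar p f x =
     (\<Sum>is | fibre_coeff p is x \<noteq> 0.
        (\<i> * of_real hbar) ^ length is * fibre_coeff p is x * pds is f x)"

text \<open>In the affine coordinates given by \<open>A\<close>, the operator \<open>T\<close> on \<open>lam\<close>-densities is identified by
  normal ordering with the coordinate symbol \<open>\<sigma>\<close>.\<close>

definition identified_with ::
  "real \<Rightarrow> real \<Rightarrow> real^('n::finite option)^('n option) \<Rightarrow> ('n density \<Rightarrow> 'n density)
    \<Rightarrow> (real^'n \<Rightarrow> real^'n \<Rightarrow> complex) \<Rightarrow> bool"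
  where "identified_with hbar lam A T \<sigma> \<longleftrightarrow>
     \<sigma> \<in> fibre_poly \<and> (\<forall>\<phi> \<in> densities lam. T \<phi> A = normal_ordering hbar \<sigma> (\<phi> A))"

text \<open>
  Linear differential operators from \<open>lam\<close>- to \<open>mu\<close>-densities; linearity follows from the local form.
  As \<open>hbar \<noteq> 0\<close> in all uses, its presence does not restrict the operators.
\<close>

definition diff_ops :: "real \<Rightarrow> real \<Rightarrow> real \<Rightarrow> (('n::finite) density \<Rightarrow> 'n density) set"
  where "diff_ops hbar lam mu = {T \<in> densities lam \<rightarrow>\<^sub>E densities mu.
     \<forall>A. invertible A \<longrightarrow> (\<exists>\<sigma>. identified_with hbar lam A T \<sigma>)}"


section \<open>Projectively equivariant quantization\<close>

text \<open>
  Push-forward of a density or a symbol by the diffeomorphism \<open>u \<mapsto> g u / |g u|\<close> of the sphere.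
  This diffeomorphism carries the coordinate system of the frame \<open>g\<^sup>-\<^sup>1 A\<close> to that of \<open>A\<close>, hence the
  expression of the push-forward in the coordinates \<open>A\<close> is that of the original object
  in the coordinates \<open>g\<^sup>-\<^sup>1 A\<close>.
\<close>

definition act ::
  "real^('n::finite option)^('n option) \<Rightarrow> (real^('n option)^('n option) \<Rightarrow> 'b)
    \<Rightarrow> real^('n option)^('n option) \<Rightarrow> 'b"
  where "act g \<phi> = (\<lambda>A. \<phi> (matrix_inv g ** A))"

definition act_op ::
  "real \<Rightarrow> real^('n::finite option)^('n option) \<Rightarrow> ('n density \<Rightarrow> 'n density)
    \<Rightarrow> 'n density \<Rightarrow> 'n density"
  where "act_op lam g T = (\<lambda>\<phi> \<in> densities lam. act g (T (act (matrix_inv g) \<phi>)))"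

definition equivariant_quantization ::
  "real \<Rightarrow> real \<Rightarrow> real \<Rightarrow> (('n::finite) symbol \<Rightarrow> 'n density \<Rightarrow> 'n density) \<Rightarrow> bool"
  where "equivariant_quantization hbar lam mu Q \<longleftrightarrow>
     bij_betw Q (symbols (mu - lam)) (diff_ops hbar lam mu) \<and>
     (\<forall>P \<in> symbols (mu - lam). \<forall>R \<in> symbols (mu - lam). \<forall>a b. \<forall>\<phi> \<in> densities lam. \<forall>A x.
        Q (\<lambda>A x \<xi>. a * P A x \<xi> + b * R A x \<xi>) \<phi> A x = a * Q P \<phi> A x + b * Q R \<phi> A x) \<and>
     (\<forall>g P. det g = 1 \<longrightarrow> P \<in> symbols (mu - lam) \<longrightarrow> Q (act g P) = act_op lam g (Q P)) \<and>
     (\<forall>k. \<forall>P \<in> homogeneous_symbols k (mu - lam). \<forall>A. invertible A \<longrightarrow>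
        (\<exists>r. (\<forall>j. r j \<in> homogeneous_poly j) \<and>
           identified_with hbar lam A (Q P) (\<lambda>x \<xi>. P A x \<xi> + (\<Sum>j<k. r j x \<xi>))))"


section \<open>Operators on coordinate symbols\<close>

definition divergence ::
  "(real^'n::finite \<Rightarrow> real^'n \<Rightarrow> complex) \<Rightarrow> real^'n \<Rightarrow> real^'n \<Rightarrow> complex"
  where "divergence p = (\<lambda>x \<xi>. \<Sum>i\<in>UNIV. pd i (\<lambda>y. pd i (p y) \<xi>) x)"

text \<open>The function \<open>t \<mapsto> p x (t \<xi>)\<close> as a polynomial in \<open>t\<close>: its coefficient of degree \<open>j\<close> is the
  component of \<open>p\<close> on which the degree operator \<open>\<E> = \<xi>\<^sub>i \<partial>/\<partial>\<xi>\<^sub>i\<close> has the value \<open>j\<close>.\<close>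

definition ray_poly :: "(real^'n::finite \<Rightarrow> real^'n \<Rightarrow> complex) \<Rightarrow> real^'n \<Rightarrow> real^'n \<Rightarrow> complex poly"
  where "ray_poly p x \<xi> = (THE q. \<forall>t::real. poly q (of_real t) = p x (t *\<^sub>R \<xi>))"

definition coeff_of_degree_op ::
  "(real \<Rightarrow> real) \<Rightarrow> (real^'n::finite \<Rightarrow> real^'n \<Rightarrow> complex) \<Rightarrow> real^'n \<Rightarrow> real^'n \<Rightarrow> complex"
  where "coeff_of_degree_op c p =
     (\<lambda>x \<xi>. \<Sum>j\<le>degree (ray_poly p x \<xi>). of_real (c (real j)) * coeff (ray_poly p x \<xi>) j)"

text \<open>
  The quotient \<open>(a\<^sub>2)\<^sub>m / ((b\<^sub>1)\<^sub>m (b\<^sub>2)\<^sub>m)\<close> for \<open>a\<^sub>2 = 2 b\<^sub>1\<close>.  In the case 0/0 (so \<open>m > 0\<close>) the common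
  factor is cancelled:  \<open>(a\<^sub>2)\<^sub>m / (b\<^sub>1)\<^sub>m = 2 (a\<^sub>2 + 1)\<^sub>m\<^sub>-\<^sub>1 / (b\<^sub>1 + 1)\<^sub>m\<^sub>-\<^sub>1\<close>.
\<close>

definition poch_quotient :: "real \<Rightarrow> real \<Rightarrow> real \<Rightarrow> nat \<Rightarrow> real"
  where "poch_quotient a2 b1 b2 m =
     (if pochhammer a2 m = 0 \<and> pochhammer b1 m * pochhammer b2 m = 0
      then 2 * pochhammer (a2 + 1) (m - 1) / (pochhammer (b1 + 1) (m - 1) * pochhammer b2 m)
      else pochhammer a2 m / (pochhammer b1 m * pochhammer b2 m))"

text \<open>\<open>F(A\<^sub>1, A\<^sub>2; B\<^sub>1, B\<^sub>2 | Z) p = \<sigma>\<close>, where the parameters are functions of the value of the degree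
  operator, \<open>Z\<close> is an operator on symbols, and the series converges pointwise.\<close>

definition hypergeometric_sums ::
  "(real \<Rightarrow> real) \<Rightarrow> (real \<Rightarrow> real) \<Rightarrow> (real \<Rightarrow> real) \<Rightarrow> (real \<Rightarrow> real)
    \<Rightarrow> ((real^'n::finite \<Rightarrow> real^'n \<Rightarrow> complex) \<Rightarrow> real^'n \<Rightarrow> real^'n \<Rightarrow> complex)
    \<Rightarrow> (real^'n \<Rightarrow> real^'n \<Rightarrow> complex) \<Rightarrow> (real^'n \<Rightarrow> real^'n \<Rightarrow> complex) \<Rightarrow> bool"
  where "hypergeometric_sums A1 A2 B1 B2 Z p \<sigma> \<longleftrightarrow> (\<forall>x \<xi>.
     (\<lambda>m. coeff_of_degree_op
            (\<lambda>e. pochhammer (A1 e) m * poch_quotient (A2 e) (B1 e) (B2 e) m)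
            ((Z ^^ m) p) x \<xi> / fact m) sums \<sigma> x \<xi>)"


section \<open>The known formula in affine coordinates\<close>

text \<open>
  The explicit form of the equivariant quantization map in affine coordinates, which is a theorem
  in the literature and is not proved here; \<open>d\<close> stands for \<open>n + 1\<close>.
\<close>

fun quant_coeff :: "real \<Rightarrow> real \<Rightarrow> real \<Rightarrow> nat \<Rightarrow> nat \<Rightarrow> real"
  where
    "quant_coeff d lam \<delta> k 0 = 1"
  | "quant_coeff d lam \<delta> k (Suc m) =
       (real k - real m - 1 + d * lam)
       / ((real m + 1) * (2 * real k - real m - 2 + d * (1 - \<delta>))) * quant_coeff d lam \<delta> k m"

definition known_affine_formula ::
  "real \<Rightarrow> real \<Rightarrow> real \<Rightarrow> (('n::finite) symbol \<Rightarrow> 'n density \<Rightarrow> 'n density) \<Rightarrow> bool"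
  where "known_affine_formula hbar lam mu Q \<longleftrightarrow>
     (\<forall>k. \<forall>P \<in> homogeneous_symbols k (mu - lam). \<forall>A. invertible A \<longrightarrow>
        identified_with hbar lam A (Q P)
          (\<lambda>x \<xi>. \<Sum>m\<le>k. of_real (quant_coeff (real CARD('n) + 1) lam (mu - lam) k m)
             * (\<i> * of_real hbar) ^ m * (divergence ^^ m) (P A) x \<xi>))"

end

theory Submission
  imports Defs
begin

text \<open>
  Write \<open>d = n + 1\<close> and \<open>\<nu> = d (1 - \<delta>)\<close>.  On a symbol that is homogeneous of degree \<open>k\<close>, the
  \<open>m\<close>-th power of the divergence lands in degree \<open>k - m\<close>, so the coefficient of the
  \<open>m\<close>-th term of the hypergeometric series is evaluated at \<open>\<E> = k - m\<close>.  There
  \<open>B\<^sub>2 = B\<^sub>1 + 1/2\<close> and \<open>A\<^sub>2 = 2 B\<^sub>1\<close>, and the duplication formula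
  \<open>(2b)\<^sub>2\<^sub>m = 4\<^sup>m (b)\<^sub>m (b + 1/2)\<^sub>m\<close> collapses \<open>(A\<^sub>2)\<^sub>m / ((B\<^sub>1)\<^sub>m (B\<^sub>2)\<^sub>m)\<close> to \<open>4\<^sup>m / (2k - m - 1 + \<nu>)\<^sub>m\<close>.
  This denominator is the product of the denominators in the recursion for the known coefficients;
  the numerators multiply to \<open>(k - m + d \<lambda>)\<^sub>m\<close>, which is \<open>(A\<^sub>1)\<^sub>m\<close>.  The exclusion of the resonant
  values of \<open>\<delta>\<close> keeps the denominators away from 0
  (\<open>poch_quotient_duplication\<close>, \<open>quant_coeff_hypergeometric\<close>).

  It remains to pass from homogeneous symbols to arbitrary ones.  A symbol is the sum of its
  homogeneous components in every affine chart, and since fibre coordinates transform linearly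
  these local components glue to global symbols.  The degree is bounded only chart by chart, but
  finitely many charts cover the sphere, so one bound serves all charts
  (\<open>symbol_degree_bounded\<close>) and the symbol is a finite sum of global homogeneous ones.  Linearity of the
  quantization and of normal ordering then reduces the theorem to the known formula in each degree;
  as the divergence is nilpotent on symbols of bounded degree, the series is a finite sum.
\<close>

section \<open>Coefficients\<close>

lemma quant_coeff_closed_form:
  "quant_coeff d lam \<delta> k m =
     pochhammer (real k - real m + d * lam) m
     / (fact m * pochhammer (2 * real k - real m - 1 + d * (1 - \<delta>)) m)"
proof (induction m)
  case 0
  show ?case by simp
next
  case (Suc m)
  define a where "a = real k - real m - 1 + d * lam"
  define b where "b = 2 * real k - real m - 2 + d * (1 - \<delta>)"
  have eqs: "real k - real m + d * lam = a + 1" "2 * real k - real m - 1 + d * (1 - \<delta>) = b + 1"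
    "real k - real (Suc m) + d * lam = a" "2 * real k - real (Suc m) - 1 + d * (1 - \<delta>) = b"
    by (simp_all add: a_def b_def)
  have "quant_coeff d lam \<delta> k (Suc m) = a / ((real m + 1) * b) * quant_coeff d lam \<delta> k m"
    by (simp add: a_def b_def)
  then show ?case
    unfolding Suc.IH eqs pochhammer_rec fact_Suc by (simp add: algebra_simps)
qed

text \<open>
  Since \<open>(2b)\<^sub>2\<^sub>m = (2b)\<^sub>m (2b + m)\<^sub>m\<close>, the duplication formula for Pochhammer symbols cancels everything
  but the factor \<open>(2b + m)\<^sub>m\<close>.  The assumption leaves \<open>2b = 0\<close> as the only possible zero of \<open>(2b)\<^sub>m\<close>;
  then, for \<open>m > 0\<close>, both \<open>(2b)\<^sub>m\<close> and \<open>(b)\<^sub>m\<close> vanish, and the convention for the quotient 0/0 makes the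
  formula hold there too.
\<close>

lemma poch_quotient_duplication:
  assumes "\<And>j::nat. 1 \<le> j \<Longrightarrow> 2 * b + real j \<noteq> 0"
  shows "poch_quotient (2 * b) b (b + 1/2) m = 4 ^ m / pochhammer (2 * b + real m) m"
proof -
  have double: "pochhammer (2 * z) m * pochhammer (2 * z + real m) m
      = 4 ^ m * (pochhammer z m * pochhammer (z + 1/2) m)" for z :: real
  proof -
    have "pochhammer (2 * z) m * pochhammer (2 * z + real m) m = pochhammer (2 * z) (2 * m)"
      unfolding mult_2[of m] by (rule pochhammer_product'[symmetric])
    also have "\<dots> = 4 ^ m * (pochhammer z m * pochhammer (z + 1/2) m)"
      by (simp add: pochhammer_double power_mult)
    finally show ?thesis .
  qed
  show ?thesis
  proof (cases "b = 0 \<and> m > 0")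
    case False
    have "pochhammer (2 * b) m \<noteq> 0"
    proof
      assume "pochhammer (2 * b) m = 0"
      then obtain j where "j < m" "2 * b = - real j" by (auto simp: pochhammer_eq_0_iff)
      then show False using False assms[of j] by (cases "j = 0") auto
    qed
    moreover have "pochhammer (2 * b + real m) m \<noteq> 0"
    proof
      assume "pochhammer (2 * b + real m) m = 0"
      then obtain j where "j < m" "2 * b + real m = - real j" by (auto simp: pochhammer_eq_0_iff)
      then show False using assms[of "m + j"] by simp
    qed
    moreover from calculation have "pochhammer b m \<noteq> 0" "pochhammer (b + 1/2) m \<noteq> 0"
      using double[of b] by auto
    ultimately show ?thesis
      using double[of b] by (simp add: poch_quotient_def frac_eq_eq)
  next
    case True
    then obtain r where r: "m = Suc r" by (cases m) auto
    \<comment> \<open>The quotient with its common factor cancelled is \<open>2 / (1/2)\<^sub>m\<close>; duplication at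
      \<open>1/2\<close> in place of \<open>b\<close> evaluates it.\<close>
    have nz: "pochhammer (1/2 :: real) m \<noteq> 0" "pochhammer (real m) m \<noteq> 0"
      by (auto simp: pochhammer_eq_0_iff r)
    have "pochhammer 1 m * pochhammer (1 + real m) m
        = (4::real) ^ m * (pochhammer (1/2) m * pochhammer 1 m)"
      using double[of "1/2"] by simp
    then have 1: "pochhammer (1 + real m) m = 4 ^ m * pochhammer (1/2) m"
      by (simp add: pochhammer_fact[symmetric])
    have "real m * pochhammer (1 + real m) m = pochhammer (real m) (Suc m)"
      unfolding pochhammer_rec by (simp only: add.commute)
    also have "\<dots> = real m * (2 * pochhammer (real m) m)"
      unfolding pochhammer_rec' by simp
    finally have 2: "pochhammer (1 + real m) m = 2 * pochhammer (real m) m"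
      unfolding mult_cancel_left using r by (metis nat.distinct(1) of_nat_eq_0_iff)
    have "poch_quotient (2 * b) b (b + 1/2) m = 2 / pochhammer (1/2) m"
      using True by (simp add: poch_quotient_def r pochhammer_0_left pochhammer_fact[symmetric])
    also have "\<dots> = 4 ^ m / pochhammer (real m) m"
      using 1 2 nz by (simp add: field_simps)
    finally show ?thesis using True by simp
  qed
qed

text \<open>
  The power \<open>4\<^sup>m\<close> is compensated by the factor \<open>1/4\<close> in the operator variable of the series.
\<close>

lemma quant_coeff_hypergeometric:
  assumes nonres: "\<And>l::nat. d * (1 - \<delta>) \<noteq> - real l" and "m \<le> k"
  defines "e \<equiv> real (k - m)"
  shows "pochhammer (e + d * lam) m
      * poch_quotient (2 * e + d * (1 - \<delta>) - 1) (e + 1/2 * d * (1 - \<delta>) - 1/2)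
          (e + 1/2 * d * (1 - \<delta>)) m / fact m
    = 4 ^ m * quant_coeff d lam \<delta> k m"
proof -
  define b where "b = e + 1/2 * d * (1 - \<delta>) - 1/2"
  have "2 * b + real j \<noteq> 0" if "1 \<le> j" for j :: nat
  proof -
    \<comment> \<open>The shift \<open>j \<ge> 1\<close> absorbs the \<open>-1\<close> in \<open>2 b\<close>, so a zero would be a resonant value of \<open>\<delta>\<close>.\<close>
    have "2 * b + real j = d * (1 - \<delta>) + real (2 * (k - m) + (j - 1))"
      using that by (simp add: b_def e_def field_simps of_nat_diff)
    then show ?thesis using nonres[of "2 * (k - m) + (j - 1)"] by linarith
  qed
  then have quotient: "poch_quotient (2 * b) b (b + 1/2) m = 4 ^ m / pochhammer (2 * b + real m) m"
    by (rule poch_quotient_duplication)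
  have params: "2 * e + d * (1 - \<delta>) - 1 = 2 * b" "e + 1/2 * d * (1 - \<delta>) = b + 1/2"
    by (simp_all add: b_def field_simps)
  have shift: "2 * b + real m = 2 * real k - real m - 1 + d * (1 - \<delta>)"
    using \<open>m \<le> k\<close> by (simp add: b_def e_def of_nat_diff field_simps)
  have e: "real k - real m = e" using \<open>m \<le> k\<close> by (simp add: e_def of_nat_diff)
  have "poch_quotient (2 * e + d * (1 - \<delta>) - 1) b (e + 1/2 * d * (1 - \<delta>)) m
      = 4 ^ m / pochhammer (2 * real k - real m - 1 + d * (1 - \<delta>)) m"
    unfolding params shift[symmetric] by (rule quotient)
  then show ?thesis
    unfolding quant_coeff_closed_form b_def[symmetric] e by (simp add: mult.commute)
qed

section \<open>Linearity of partial derivatives\<close>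

lemma has_vector_derivative_pd:
  assumes "f differentiable (at x)"
  shows "((\<lambda>t. f (x + t *\<^sub>R axis i 1)) has_vector_derivative pd i f x) (at 0)"
proof -
  have "(f \<circ> (\<lambda>t. x + t *\<^sub>R axis i 1)) differentiable (at 0)"
    using assms by (intro differentiable_chain_at derivative_intros) simp
  then show ?thesis
    unfolding pd_def by (simp add: o_def vector_derivative_works[symmetric])
qed

lemma pd_lincomb:
  assumes "\<And>s. s \<in> S \<Longrightarrow> f s differentiable (at x)"
  shows "pd i (\<lambda>x. \<Sum>s\<in>S. a s * f s x) x = (\<Sum>s\<in>S. a s * pd i (f s) x)"
  unfolding pd_def
  by (intro vector_derivative_at has_vector_derivative_sum has_vector_derivative_mult_right)
    (auto intro!: has_vector_derivative_pd[unfolded pd_def] assms)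

lemma smooth_imp_differentiable: "smooth f \<Longrightarrow> f differentiable (at x)"
  unfolding smooth_def by (metis pds_def foldr.simps(1) id_apply)

lemma smooth_pd: "smooth f \<Longrightarrow> smooth (pd i f)"
  unfolding smooth_def
proof (intro allI)
  fix "is" x assume "\<forall>is x. pds is f differentiable at x"
  then have "pds (is @ [i]) f differentiable at x" by blast
  then show "pds is (pd i f) differentiable at x" by (simp add: pds_def)
qed

lemma smooth_pds: "smooth f \<Longrightarrow> smooth (pds is f)"
  by (induction "is") (simp_all add: pds_def smooth_pd)

lemma pds_lincomb:
  assumes "\<And>s. s \<in> S \<Longrightarrow> smooth (f s)"
  shows "pds is (\<lambda>x. \<Sum>s\<in>S. a s * f s x) = (\<lambda>x. \<Sum>s\<in>S. a s * pds is (f s) x)"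
proof (induction "is")
  case Nil
  show ?case by (simp add: pds_def)
next
  case (Cons i "is")
  have "pds (i # is) (\<lambda>x. \<Sum>s\<in>S. a s * f s x) = pd i (\<lambda>x. \<Sum>s\<in>S. a s * pds is (f s) x)"
    using Cons by (simp add: pds_def)
  also have "\<dots> = (\<lambda>x. \<Sum>s\<in>S. a s * pd i (pds is (f s)) x)"
    by (intro ext pd_lincomb smooth_imp_differentiable smooth_pds assms)
  finally show ?case by (simp add: pds_def)
qed

lemma smooth_lincomb:
  assumes "finite S" "\<And>s. s \<in> S \<Longrightarrow> smooth (f s)"
  shows "smooth (\<lambda>x. \<Sum>s\<in>S. a s * f s x)"
  unfolding smooth_def
proof (intro allI)
  fix "is" x
  have "(\<lambda>x. \<Sum>s\<in>S. a s * pds is (f s) x) differentiable at x"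
    by (intro differentiable_sum[OF assms(1)] ballI differentiable_mult differentiable_const
          smooth_imp_differentiable smooth_pds assms)
  then show "pds is (\<lambda>x. \<Sum>s\<in>S. a s * f s x) differentiable at x"
    using assms(2) by (simp add: pds_lincomb)
qed

section \<open>Homogeneous polynomials\<close>

lemma finite_lists_of_length: "finite {is :: 'n::finite list. length is = k}"
  using finite_lists_length_eq[of "UNIV :: 'n set" k] by simp

lemma homogeneous_polyI:
  assumes "\<And>is. smooth (P is)" "\<And>x \<xi>. p x \<xi> = tensor_poly k (\<lambda>is. P is x) \<xi>"
  shows "p \<in> homogeneous_poly k"
  unfolding homogeneous_poly_def using assms by (auto simp: tensor_poly_def fun_eq_iff)

text \<open>
  Averaging the coefficients over all rearrangements of a multi-index leaves the polynomial
  unchanged, because the monomial depends only on the multiset of indices.  Symmetric coefficients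
  make fibre derivatives act by shifting the multi-index.
\<close>

lemma homogeneous_poly_symmetric_coeffs:
  fixes p :: "real^'n::finite \<Rightarrow> real^'n \<Rightarrow> complex"
  assumes "p \<in> homogeneous_poly k"
  shows "\<exists>P. (\<forall>is. smooth (P is)) \<and> (\<forall>is js. mset is = mset js \<longrightarrow> P is = P js)
    \<and> p = (\<lambda>x. tensor_poly k (\<lambda>is. P is x))"
proof -
  from assms obtain R :: "'n list \<Rightarrow> real^'n \<Rightarrow> complex" where R: "\<And>is. smooth (R is)"
    and p: "p = (\<lambda>x \<xi>. \<Sum>is | length is = k. R is x * of_real (\<Prod>i\<leftarrow>is. \<xi> $ i))"
    by (auto simp: homogeneous_poly_def)
  define cls where "cls is = {js :: 'n list. mset js = mset is}" for "is"
  define P where "P is x = (\<Sum>js\<in>cls is. (1 / of_nat (card (cls is))) * R js x)" for "is" x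
  have fin: "finite (cls is)" for "is"
    by (rule finite_subset[OF _ finite_lists_of_length[of "length is"]])
      (auto simp: cls_def dest: mset_eq_length)
  have cls_eq: "cls is = cls js" if "mset is = mset js" for "is" js
    using that by (simp add: cls_def)
  have "smooth (P is)" for "is"
    unfolding P_def by (intro smooth_lincomb fin R)
  moreover have "P is = P js" if "mset is = mset js" for "is" js
    unfolding P_def cls_eq[OF that] ..
  moreover have "p = (\<lambda>x. tensor_poly k (\<lambda>is. P is x))"
  proof (intro ext)
    fix x \<xi> :: "real^'n"
    let ?L = "{is :: 'n list. length is = k}"
    let ?pr = "\<lambda>is. of_real (\<Prod>i\<leftarrow>is. \<xi> $ i) :: complex"
    let ?N = "\<lambda>is. of_nat (card (cls is)) :: complex"
    have pr: "?pr is = ?pr js" if "mset is = mset js" for "is" js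
      using that by (metis mset_map prod_mset_prod_list)
    have cl: "cls is = {js \<in> ?L. mset js = mset is}" if "is \<in> ?L" for "is"
      using that by (auto simp: cls_def dest: mset_eq_length)
    have N: "card (cls is) \<noteq> 0" for "is"
      using fin[of "is"] by (auto simp: cls_def)
    have "tensor_poly k (\<lambda>is. P is x) \<xi>
        = (\<Sum>is\<in>?L. \<Sum>js\<in>{js \<in> ?L. mset js = mset is}. 1 / ?N is * R js x * ?pr is)"
      by (simp add: tensor_poly_def P_def sum_distrib_right cl)
    \<comment> \<open>Move the weight and the monomial to the inner index, which rearranges the outer one; after
      exchanging the sums each \<open>js\<close> is counted as often as its weight compensates.\<close>
    also have "\<dots> = (\<Sum>is\<in>?L. \<Sum>js\<in>{js \<in> ?L. mset js = mset is}. 1 / ?N js * R js x * ?pr js)"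
    proof (intro sum.cong refl)
      fix "is" js assume "js \<in> {js \<in> ?L. mset js = mset is}"
      then have "mset js = mset is" by simp
      from pr[OF this] cls_eq[OF this]
      show "1 / ?N is * R js x * ?pr is = 1 / ?N js * R js x * ?pr js" by simp
    qed
    also have "\<dots> = (\<Sum>js\<in>?L. \<Sum>is\<in>{is \<in> ?L. mset js = mset is}. 1 / ?N js * R js x * ?pr js)"
      by (rule sum.swap_restrict) (simp_all add: finite_lists_of_length)
    also have "\<dots> = (\<Sum>js\<in>?L. ?N js * (1 / ?N js * R js x * ?pr js))"
    proof (intro sum.cong refl)
      fix js assume "js \<in> ?L"
      then have "{is \<in> ?L. mset js = mset is} = cls js"
        unfolding cl[OF \<open>js \<in> ?L\<close>] by metis
      then show "(\<Sum>is\<in>{is \<in> ?L. mset js = mset is}. 1 / ?N js * R js x * ?pr js)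
          = ?N js * (1 / ?N js * R js x * ?pr js)"
        by simp
    qed
    also have "\<dots> = p x \<xi>"
      by (simp add: p N)
    finally show "p x \<xi> = tensor_poly k (\<lambda>is. P is x) \<xi>" ..
  qed
  ultimately show ?thesis by blast
qed

lemma homogeneous_poly_lincomb:
  assumes "finite S" "\<And>s. s \<in> S \<Longrightarrow> q s \<in> homogeneous_poly k"
  shows "(\<lambda>x \<xi>. \<Sum>s\<in>S. a s * q s x \<xi>) \<in> homogeneous_poly k"
proof -
  have "\<forall>s\<in>S. \<exists>P. (\<forall>is. smooth (P is)) \<and> q s = (\<lambda>x. tensor_poly k (\<lambda>is. P is x))"
    using assms(2) homogeneous_poly_symmetric_coeffs by blast
  then obtain P where P: "\<And>s is. s \<in> S \<Longrightarrow> smooth (P s is)"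
      "\<And>s. s \<in> S \<Longrightarrow> q s = (\<lambda>x. tensor_poly k (\<lambda>is. P s is x))"
    by metis
  show ?thesis
  proof (rule homogeneous_polyI[where P = "\<lambda>is x. \<Sum>s\<in>S. a s * P s is x"])
    show "smooth (\<lambda>x. \<Sum>s\<in>S. a s * P s is x)" for "is"
      by (intro smooth_lincomb assms P)
    show "(\<Sum>s\<in>S. a s * q s x \<xi>) = tensor_poly k (\<lambda>is. \<Sum>s\<in>S. a s * P s is x) \<xi>" for x \<xi>
      by (simp add: P(2) tensor_poly_def sum_distrib_left sum_distrib_right mult.assoc)
        (rule sum.swap)
  qed
qed

lemma zero_homogeneous_poly: "(\<lambda>x \<xi>. 0) \<in> homogeneous_poly k"
  using homogeneous_poly_lincomb[of "{}"] by simp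

lemma homogeneous_poly_scaleR:
  assumes "p \<in> homogeneous_poly k"
  shows "p x (t *\<^sub>R \<xi>) = of_real t ^ k * p x \<xi>"
proof -
  have "(\<Prod>i\<leftarrow>is. (t *\<^sub>R \<xi>) $ i) = t ^ length is * (\<Prod>i\<leftarrow>is. \<xi> $ i)" for "is"
    by (induction "is") auto
  moreover obtain P where "p = (\<lambda>x. tensor_poly k (\<lambda>is. P is x))"
    using homogeneous_poly_symmetric_coeffs[OF assms] by blast
  ultimately show ?thesis
    by (simp add: tensor_poly_def sum_distrib_left mult_ac)
qed

lemma differentiable_tensor_poly: "tensor_poly k c differentiable (at \<xi>)"
proof (induction k arbitrary: c)
  case 0
  show ?case by simp
next
  case (Suc k)
  have "(\<lambda>\<xi>. of_real (\<xi> $ i) :: complex) differentiable (at \<xi>)" for i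
    by (intro bounded_linear_imp_differentiable bounded_linear_compose[OF bounded_linear_of_real]
        bounded_linear_vec_nth)
  then have "(\<lambda>\<xi>. \<Sum>i\<in>UNIV. of_real (\<xi> $ i) * tensor_poly k (\<lambda>is. c (i # is)) \<xi>)
      differentiable (at \<xi>)"
    by (intro differentiable_sum ballI differentiable_mult Suc.IH) auto
  then show ?case by (simp add: tensor_poly_Suc[abs_def])
qed

lemma homogeneous_poly_smooth_fibre:
  assumes "p \<in> homogeneous_poly k"
  shows "smooth (p x)"
proof -
  obtain P where P: "\<And>is js. mset is = mset js \<Longrightarrow> P is = P js"
      "p = (\<lambda>x. tensor_poly k (\<lambda>is. P is x))"
    using homogeneous_poly_symmetric_coeffs[OF assms] by blast
  have pds_p: "pds js (p x) = (\<lambda>\<xi>. if length js \<le> k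
           then fact k / fact (k - length js)
             * tensor_poly (k - length js) (\<lambda>is. P (js @ is) x) \<xi> else 0)" for js
    unfolding P(2) by (rule pds_tensor_poly) (rule arg_cong[OF P(1), of _ _ "\<lambda>f. f x"])
  show ?thesis
    unfolding smooth_def
  proof (intro allI)
    fix "is" \<xi>
    show "pds is (p x) differentiable (at \<xi>)"
      unfolding pds_p
      by (cases "length is \<le> k"; simp only: if_True if_False)
        (intro differentiable_mult differentiable_const differentiable_tensor_poly)+
  qed
qed

text \<open>
  Ensures that normal ordering of a fibrewise polynomial is a genuinely finite sum, and hence that
  it is additive.
\<close>

lemma fibre_coeff_homogeneous:
  assumes "p \<in> homogeneous_poly k" "length js \<noteq> k"
  shows "fibre_coeff p js x = 0"
proof -
  obtain P where P: "\<And>is js. mset is = mset js \<Longrightarrow> P is = P js"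
      "p = (\<lambda>x. tensor_poly k (\<lambda>is. P is x))"
    using homogeneous_poly_symmetric_coeffs[OF assms(1)] by blast
  show ?thesis
    using fibre_coeff_sum[of P k js x, OF P(1)] assms(2)
    unfolding P(2) tensor_poly_def[abs_def] by simp
qed

section \<open>The divergence\<close>

lemma pd_fibre_homogeneous:
  assumes "\<And>is js. mset is = mset js \<Longrightarrow> P is = P js"
  shows "pd i (tensor_poly k (\<lambda>is. P is y)) \<xi>
    = (\<Sum>is | length is = k - 1. of_nat k * of_real (\<Prod>i\<leftarrow>is. \<xi> $ i) * P (i # is) y)"
proof -
  have "P is y = P js y" if "mset is = mset js" for "is" js
    using assms[OF that] by simp
  from pd_tensor_poly[where a = 1 and k = k and c = "\<lambda>is. P is y" and j = i, OF this]
  have "pd i (tensor_poly k (\<lambda>is. P is y)) \<xi>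
      = of_nat k * tensor_poly (k - 1) (\<lambda>is. P (i # is) y) \<xi>"
    by (simp add: fun_eq_iff)
  then show ?thesis by (simp only:) (simp add: tensor_poly_def sum_distrib_left mult_ac)
qed

lemma smooth_pd_fibre_homogeneous:
  assumes "p \<in> homogeneous_poly k"
  shows "smooth (\<lambda>y. pd i (p y) \<xi>)"
proof -
  obtain P where P: "\<And>is. smooth (P is)" "\<And>is js. mset is = mset js \<Longrightarrow> P is = P js"
      "p = (\<lambda>x. tensor_poly k (\<lambda>is. P is x))"
    using homogeneous_poly_symmetric_coeffs[OF assms] by blast
  have "pd i (tensor_poly k (\<lambda>is. P is y)) \<xi>
    = (\<Sum>is | length is = k - 1. of_nat k * of_real (\<Prod>i\<leftarrow>is. \<xi> $ i) * P (i # is) y)" for y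
    by (rule pd_fibre_homogeneous) (rule P(2))
  then show ?thesis
    unfolding P(3) by (simp only:) (intro smooth_lincomb finite_lists_of_length P)
qed

text \<open>
  The fibre derivative takes one index of the symmetric coefficient tensor out of the monomial, and
  the base derivative contracts it; the drop in degree by one and the smoothness of the new
  coefficients can be read off.
\<close>

lemma divergence_tensor_poly:
  fixes P :: "'n::finite list \<Rightarrow> real^'n \<Rightarrow> complex"
  assumes "\<And>is. smooth (P is)" "\<And>is js. mset is = mset js \<Longrightarrow> P is = P js"
  shows "divergence (\<lambda>x. tensor_poly k (\<lambda>is. P is x)) x \<xi>
    = tensor_poly (k - 1) (\<lambda>is. \<Sum>i\<in>UNIV. of_nat k * pd i (P (i # is)) x) \<xi>"
proof -
  have "pd i (\<lambda>y. pd i (tensor_poly k (\<lambda>is. P is y)) \<xi>) x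
     = (\<Sum>is | length is = k - 1. of_nat k * of_real (\<Prod>i\<leftarrow>is. \<xi> $ i) * pd i (P (i # is)) x)" for i
  proof -
    have "pd i (tensor_poly k (\<lambda>is. P is y)) \<xi>
      = (\<Sum>is | length is = k - 1. of_nat k * of_real (\<Prod>i\<leftarrow>is. \<xi> $ i) * P (i # is) y)" for y
      by (rule pd_fibre_homogeneous) (rule assms(2))
    then show ?thesis
      by (simp only:) (intro pd_lincomb smooth_imp_differentiable assms)
  qed
  then have "divergence (\<lambda>x. tensor_poly k (\<lambda>is. P is x)) x \<xi>
     = (\<Sum>i\<in>UNIV. \<Sum>is | length is = k - 1.
          of_nat k * of_real (\<Prod>i\<leftarrow>is. \<xi> $ i) * pd i (P (i # is)) x)"
    by (simp add: divergence_def)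
  also have "\<dots> = (\<Sum>is | length is = k - 1. \<Sum>i\<in>UNIV.
          of_nat k * of_real (\<Prod>i\<leftarrow>is. \<xi> $ i) * pd i (P (i # is)) x)"
    by (rule sum.swap)
  finally show ?thesis
    by (simp add: tensor_poly_def sum_distrib_left mult_ac)
qed

lemma divergence_homogeneous:
  assumes "p \<in> homogeneous_poly k"
  shows "divergence p \<in> homogeneous_poly (k - 1)"
proof -
  obtain P where P: "\<And>is. smooth (P is)" "\<And>is js. mset is = mset js \<Longrightarrow> P is = P js"
      "p = (\<lambda>x. tensor_poly k (\<lambda>is. P is x))"
    using homogeneous_poly_symmetric_coeffs[OF assms] by blast
  show ?thesis
    by (rule homogeneous_polyI[where P = "\<lambda>is x. \<Sum>i\<in>UNIV. of_nat k * pd i (P (i # is)) x"])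
      (auto simp: P(3) divergence_tensor_poly[of P, OF P(1,2)] intro!: smooth_lincomb smooth_pd P(1))
qed

lemma divergence_homogeneous_0:
  assumes "p \<in> homogeneous_poly 0"
  shows "divergence p = (\<lambda>x \<xi>. 0)"
proof -
  obtain P where P: "\<And>is. smooth (P is)" "\<And>is js. mset is = mset js \<Longrightarrow> P is = P js"
      "p = (\<lambda>x. tensor_poly 0 (\<lambda>is. P is x))"
    using homogeneous_poly_symmetric_coeffs[OF assms] by blast
  show ?thesis
    using divergence_tensor_poly[of P 0, OF P(1,2)] by (auto simp: P(3) fun_eq_iff)
qed

lemma divergence_power_homogeneous:
  assumes "p \<in> homogeneous_poly k"
  shows "(divergence ^^ m) p \<in> homogeneous_poly (k - m)"
proof (induction m)
  case 0
  show ?case using assms by simp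
next
  case (Suc m)
  show ?case using divergence_homogeneous[OF Suc] by simp
qed

lemma divergence_zero: "divergence (\<lambda>x \<xi>. 0) = (\<lambda>x \<xi>. 0)"
  by (rule divergence_homogeneous_0) (rule zero_homogeneous_poly)

lemma divergence_power_vanishes:
  assumes "p \<in> homogeneous_poly k" "k < m"
  shows "(divergence ^^ m) p = (\<lambda>x \<xi>. 0)"
  using \<open>k < m\<close>
proof (induction m)
  case (Suc m)
  show ?case
  proof (cases "k < m")
    case True
    then show ?thesis using Suc by (simp add: divergence_zero)
  next
    case False
    then show ?thesis
      using Suc.prems divergence_power_homogeneous[OF assms(1), of m]
      by (simp add: divergence_homogeneous_0)
  qed
qed simp

lemma divergence_lincomb:
  assumes "finite S" "\<And>s. s \<in> S \<Longrightarrow> q s \<in> homogeneous_poly (d s)"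
  shows "divergence (\<lambda>x \<xi>. \<Sum>s\<in>S. a s * q s x \<xi>) = (\<lambda>x \<xi>. \<Sum>s\<in>S. a s * divergence (q s) x \<xi>)"
proof (intro ext)
  fix x \<xi>
  have 1: "pd i (\<lambda>\<xi>. \<Sum>s\<in>S. a s * q s y \<xi>) \<xi> = (\<Sum>s\<in>S. a s * pd i (q s y) \<xi>)" for i y
    using assms
    by (intro pd_lincomb smooth_imp_differentiable homogeneous_poly_smooth_fibre) auto
  have 2: "pd i (\<lambda>y. \<Sum>s\<in>S. a s * pd i (q s y) \<xi>) x = (\<Sum>s\<in>S. a s * pd i (\<lambda>y. pd i (q s y) \<xi>) x)" for i
    using assms
    by (intro pd_lincomb smooth_imp_differentiable smooth_pd_fibre_homogeneous) auto
  have "divergence (\<lambda>x \<xi>. \<Sum>s\<in>S. a s * q s x \<xi>) x \<xi>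
      = (\<Sum>i\<in>UNIV. \<Sum>s\<in>S. a s * pd i (\<lambda>y. pd i (q s y) \<xi>) x)"
    by (simp add: divergence_def 1 2)
  also have "\<dots> = (\<Sum>s\<in>S. \<Sum>i\<in>UNIV. a s * pd i (\<lambda>y. pd i (q s y) \<xi>) x)"
    by (rule sum.swap)
  finally show "divergence (\<lambda>x \<xi>. \<Sum>s\<in>S. a s * q s x \<xi>) x \<xi> = (\<Sum>s\<in>S. a s * divergence (q s) x \<xi>)"
    by (simp add: divergence_def sum_distrib_left)
qed

lemma scaled_divergence_power:
  assumes "finite S" "\<And>s. s \<in> S \<Longrightarrow> q s \<in> homogeneous_poly (d s)"
  shows "((\<lambda>p x \<xi>. c * divergence p x \<xi>) ^^ m) (\<lambda>x \<xi>. \<Sum>s\<in>S. q s x \<xi>)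
    = (\<lambda>x \<xi>. \<Sum>s\<in>S. c ^ m * (divergence ^^ m) (q s) x \<xi>)"
proof (induction m)
  case 0
  show ?case by simp
next
  case (Suc m)
  have "divergence (\<lambda>x \<xi>. \<Sum>s\<in>S. c ^ m * (divergence ^^ m) (q s) x \<xi>)
      = (\<lambda>x \<xi>. \<Sum>s\<in>S. c ^ m * divergence ((divergence ^^ m) (q s)) x \<xi>)"
    by (rule divergence_lincomb[where d = "\<lambda>s. d s - m"])
      (auto intro: assms divergence_power_homogeneous)
  then show ?case
    by (simp add: Suc sum_distrib_left mult.assoc)
qed

section \<open>The degree operator\<close>

text \<open>
  A complex polynomial is determined by its values on the real line, so the description in
  \<open>ray_poly_def\<close> is satisfied by at most one polynomial.
\<close>

lemma ray_poly_eqI: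
  assumes "\<And>t::real. poly q (of_real t) = p x (t *\<^sub>R \<xi>)"
  shows "ray_poly p x \<xi> = q"
  unfolding ray_poly_def
proof (rule the_equality)
  fix r assume r: "\<forall>t::real. poly r (of_real t) = p x (t *\<^sub>R \<xi>)"
  have "infinite (range (of_real :: real \<Rightarrow> complex))"
    by (simp add: finite_image_iff inj_of_real infinite_UNIV_char_0)
  then have "infinite {z. poly r z = poly q z}"
    by (rule infinite_super[rotated]) (auto simp: r assms)
  then have "infinite {z. poly (r - q) z = 0}" by simp
  then show "r = q" using poly_roots_finite[of "r - q"] by auto
qed (use assms in simp)

lemma ray_poly_sum:
  assumes "\<And>s. s \<in> S \<Longrightarrow> q s \<in> homogeneous_poly (d s)"
  shows "ray_poly (\<lambda>x \<xi>. \<Sum>s\<in>S. q s x \<xi>) x \<xi> = (\<Sum>s\<in>S. monom (q s x \<xi>) (d s))"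
proof (rule ray_poly_eqI)
  fix t :: real
  show "poly (\<Sum>s\<in>S. monom (q s x \<xi>) (d s)) (of_real t) = (\<Sum>s\<in>S. q s x (t *\<^sub>R \<xi>))"
    by (simp add: poly_sum poly_monom homogeneous_poly_scaleR[OF assms] mult.commute)
qed

lemma coeff_of_degree_op_sum:
  assumes "finite S" "\<And>s. s \<in> S \<Longrightarrow> q s \<in> homogeneous_poly (d s)"
  shows "coeff_of_degree_op c (\<lambda>x \<xi>. \<Sum>s\<in>S. q s x \<xi>) x \<xi>
    = (\<Sum>s\<in>S. of_real (c (real (d s))) * q s x \<xi>)"
proof -
  define r where "r = (\<Sum>s\<in>S. monom (q s x \<xi>) (d s))"
  \<comment> \<open>Cancellation may lower the degree of \<open>r\<close>, so sum up to a common bound of it and all \<open>d s\<close>.\<close>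
  define N where "N = max (degree r) (Max (insert 0 (d ` S)))"
  have ray: "ray_poly (\<lambda>x \<xi>. \<Sum>s\<in>S. q s x \<xi>) x \<xi> = r"
    unfolding r_def by (rule ray_poly_sum) (rule assms(2))
  have N: "d s \<le> N" if "s \<in> S" for s
    using assms(1) that by (auto simp: N_def le_max_iff_disj intro!: disjI2 Max_ge)
  have "coeff_of_degree_op c (\<lambda>x \<xi>. \<Sum>s\<in>S. q s x \<xi>) x \<xi>
      = (\<Sum>j\<le>degree r. of_real (c (real j)) * coeff r j)"
    unfolding coeff_of_degree_op_def ray ..
  also have "\<dots> = (\<Sum>j\<le>N. of_real (c (real j)) * coeff r j)"
    by (rule sum.mono_neutral_left) (auto simp: N_def coeff_eq_0)
  also have "\<dots> = (\<Sum>j\<le>N. \<Sum>s\<in>S. if d s = j then of_real (c (real j)) * q s x \<xi> else 0)"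
    by (simp add: r_def coeff_sum sum_distrib_left if_distrib cong: if_cong)
  also have "\<dots> = (\<Sum>s\<in>S. \<Sum>j\<le>N. if d s = j then of_real (c (real j)) * q s x \<xi> else 0)"
    by (rule sum.swap)
  also have "\<dots> = (\<Sum>s\<in>S. of_real (c (real (d s))) * q s x \<xi>)"
    by (intro sum.cong refl) (auto simp: N)
  finally show ?thesis .
qed

section \<open>Fibrewise polynomials and normal ordering\<close>

lemma fibre_polyE:
  assumes "p \<in> fibre_poly"
  obtains N h where "\<And>k. h k \<in> homogeneous_poly k" "p = (\<lambda>x \<xi>. \<Sum>k\<le>N. h k x \<xi>)"
  using assms by (auto simp: fibre_poly_def)

lemma fibre_poly_smooth_fibre:
  assumes "p \<in> fibre_poly"
  shows "smooth (p x)"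
proof -
  obtain N h where h: "\<And>k. h k \<in> homogeneous_poly k" "p = (\<lambda>x \<xi>. \<Sum>k\<le>N. h k x \<xi>)"
    using assms by (rule fibre_polyE) blast
  have "smooth (\<lambda>\<xi>. \<Sum>k\<le>N. 1 * h k x \<xi>)"
    by (intro smooth_lincomb homogeneous_poly_smooth_fibre[OF h(1)]) auto
  then show ?thesis by (simp add: h(2))
qed

lemma fibre_coeff_sum_smooth:
  assumes "\<And>s. s \<in> S \<Longrightarrow> smooth (q s x)"
  shows "fibre_coeff (\<lambda>x \<xi>. \<Sum>s\<in>S. q s x \<xi>) is x = (\<Sum>s\<in>S. fibre_coeff (q s) is x)"
  using pds_lincomb[of S "\<lambda>s. q s x" "is" "\<lambda>_. 1"] assms
  by (simp add: fibre_coeff_def sum_divide_distrib)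

lemma finite_fibre_coeff_support:
  assumes "p \<in> fibre_poly"
  shows "finite {is. fibre_coeff p is x \<noteq> 0}"
proof -
  obtain N h where h: "\<And>k. h k \<in> homogeneous_poly k" "p = (\<lambda>x \<xi>. \<Sum>k\<le>N. h k x \<xi>)"
    using assms by (rule fibre_polyE) blast
  have "fibre_coeff p is x = (\<Sum>k\<le>N. fibre_coeff (h k) is x)" for "is"
    unfolding h(2) by (rule fibre_coeff_sum_smooth) (rule homogeneous_poly_smooth_fibre[OF h(1)])
  then have "fibre_coeff p is x = 0" if "length is > N" for "is"
    using that by (auto intro!: sum.neutral fibre_coeff_homogeneous[OF h(1)])
  then have "{is. fibre_coeff p is x \<noteq> 0} \<subseteq> {is. length is \<le> N}"
    by (auto simp: not_less[symmetric])
  moreover have "finite {is :: 'a list. length is \<le> N}"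
    using finite_lists_length_le[of "UNIV :: 'a set" N] by simp
  ultimately show ?thesis by (rule finite_subset)
qed

text \<open>
  The sum defining normal ordering runs over the support of the coefficients, which varies
  with the symbol; additivity becomes visible on the finite union \<open>T\<close> of the supports.
\<close>

lemma normal_ordering_sum:
  fixes q :: "'s \<Rightarrow> real^'n::finite \<Rightarrow> real^'n \<Rightarrow> complex"
  assumes "finite S" "\<And>s. s \<in> S \<Longrightarrow> q s \<in> fibre_poly"
  shows "normal_ordering hbar (\<lambda>x \<xi>. \<Sum>s\<in>S. q s x \<xi>) f x = (\<Sum>s\<in>S. normal_ordering hbar (q s) f x)"
proof -
  define T where "T = (\<Union>s\<in>S. {is. fibre_coeff (q s) is x \<noteq> 0})"
  let ?g = "\<lambda>p is. (\<i> * of_real hbar) ^ length is * fibre_coeff p is x * pds is f x"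
  have fin: "finite T" unfolding T_def by (intro finite_UN_I assms finite_fibre_coeff_support)
  have c: "fibre_coeff (\<lambda>x \<xi>. \<Sum>s\<in>S. q s x \<xi>) is x = (\<Sum>s\<in>S. fibre_coeff (q s) is x)" for "is"
    by (intro fibre_coeff_sum_smooth fibre_poly_smooth_fibre assms)
  have "normal_ordering hbar (\<lambda>x \<xi>. \<Sum>s\<in>S. q s x \<xi>) f x
      = (\<Sum>is\<in>T. ?g (\<lambda>x \<xi>. \<Sum>s\<in>S. q s x \<xi>) is)"
    unfolding normal_ordering_def
    by (rule sum.mono_neutral_left[OF fin])
      (auto simp: c T_def intro: ccontr dest: sum.not_neutral_contains_not_neutral)
  also have "\<dots> = (\<Sum>is\<in>T. \<Sum>s\<in>S. ?g (q s) is)"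
    by (simp add: c sum_distrib_left sum_distrib_right)
  also have "\<dots> = (\<Sum>s\<in>S. \<Sum>is\<in>T. ?g (q s) is)"
    by (rule sum.swap)
  also have "\<dots> = (\<Sum>s\<in>S. normal_ordering hbar (q s) f x)"
    unfolding normal_ordering_def
    by (intro sum.cong refl sum.mono_neutral_right[OF fin]) (auto simp: T_def)
  finally show ?thesis .
qed

lemma fibre_poly_add:
  assumes "p \<in> fibre_poly" "q \<in> fibre_poly"
  shows "(\<lambda>x \<xi>. p x \<xi> + q x \<xi>) \<in> fibre_poly"
proof -
  obtain M g where g: "\<And>k. g k \<in> homogeneous_poly k" "p = (\<lambda>x \<xi>. \<Sum>k\<le>M. g k x \<xi>)"
    using assms(1) by (rule fibre_polyE) blast
  obtain N h where h: "\<And>k. h k \<in> homogeneous_poly k" "q = (\<lambda>x \<xi>. \<Sum>k\<le>N. h k x \<xi>)"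
    using assms(2) by (rule fibre_polyE) blast
  \<comment> \<open>The sum of the degree \<open>k\<close> parts, written as a linear combination indexed by \<open>bool\<close>; the
    coefficients cut off each family at its own bound.\<close>
  define r where "r k x \<xi> = (\<Sum>b\<in>UNIV. (if b then if k \<le> M then 1 else 0 else if k \<le> N then 1 else 0)
     * (if b then g k else h k) x \<xi>)" for k x \<xi>
  have "r k \<in> homogeneous_poly k" for k
    unfolding r_def by (rule homogeneous_poly_lincomb) (auto simp: g h)
  moreover have "p x \<xi> + q x \<xi> = (\<Sum>k\<le>max M N. r k x \<xi>)" for x \<xi>
  proof -
    have "p x \<xi> = (\<Sum>k\<le>max M N. if k \<le> M then g k x \<xi> else 0)"
      unfolding g(2) by (rule sum.mono_neutral_cong_left) auto
    moreover have "q x \<xi> = (\<Sum>k\<le>max M N. if k \<le> N then h k x \<xi> else 0)"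
      unfolding h(2) by (rule sum.mono_neutral_cong_left) auto
    ultimately show ?thesis
      by (simp add: r_def UNIV_bool sum.distrib if_distrib[of "\<lambda>u. u * _"] add.commute cong: if_cong)
  qed
  ultimately show ?thesis unfolding fibre_poly_def by blast
qed

lemma fibre_poly_sum:
  fixes q :: "'s \<Rightarrow> real^'n::finite \<Rightarrow> real^'n \<Rightarrow> complex"
  assumes "finite S" "\<And>s. s \<in> S \<Longrightarrow> q s \<in> fibre_poly"
  shows "(\<lambda>x \<xi>. \<Sum>s\<in>S. q s x \<xi>) \<in> fibre_poly"
  using assms
proof (induction S rule: finite_induct)
  case empty
  have "\<exists>N h. (\<forall>k. h k \<in> homogeneous_poly k)
      \<and> (\<lambda>x \<xi>. 0) = (\<lambda>(x :: real^'n) (\<xi> :: real^'n). \<Sum>k\<le>N. h k x \<xi> :: complex)"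
    by (rule exI[of _ 0], rule exI[of _ "\<lambda>_ _ _. 0"]) (simp add: zero_homogeneous_poly)
  then show ?case by (simp add: fibre_poly_def)
next
  case (insert s S)
  then show ?case by (simp add: fibre_poly_add)
qed

lemma identified_with_sum:
  fixes U :: "('n::finite) density \<Rightarrow> 'n density"
  assumes "finite S" "\<And>s. s \<in> S \<Longrightarrow> identified_with hbar lam A (T s) (q s)"
    and "\<And>\<phi> x. \<phi> \<in> densities lam \<Longrightarrow> U \<phi> A x = (\<Sum>s\<in>S. T s \<phi> A x)"
  shows "identified_with hbar lam A U (\<lambda>x \<xi>. \<Sum>s\<in>S. q s x \<xi>)"
  unfolding identified_with_def
proof (intro conjI ballI ext)
  show "(\<lambda>x \<xi>. \<Sum>s\<in>S. q s x \<xi>) \<in> fibre_poly"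
    using assms(1,2) by (intro fibre_poly_sum) (auto simp: identified_with_def)
  fix \<phi> :: "'n density" and x assume "\<phi> \<in> densities lam"
  then show "U \<phi> A x = normal_ordering hbar (\<lambda>x \<xi>. \<Sum>s\<in>S. q s x \<xi>) (\<phi> A) x"
    using assms by (subst normal_ordering_sum) (auto simp: identified_with_def intro!: sum.cong)
qed

section \<open>Coordinate changes on the sphere\<close>

lemma invertible_matrix_inv:
  fixes A :: "real^'n^'n"
  assumes "invertible A"
  shows "A ** matrix_inv A = mat 1" "matrix_inv A ** A = mat 1"
  using someI_ex[OF assms[unfolded invertible_def]] by (simp_all add: matrix_inv_def)

text \<open>
  The normalisation of the ray representative cancels in the quotient, so coordinate changes are
  fractional linear maps.
\<close>

lemma transition_nth:
  "transition A B x $ i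
    = ((matrix_inv B ** A) *v affine_lift x) $ Some i / ((matrix_inv B ** A) *v affine_lift x) $ None"
proof (cases "A *v affine_lift x = 0")
  case True
  then show ?thesis
    by (simp add: transition_def affine_coords_def affine_param_def matrix_vector_mul_assoc[symmetric])
next
  case False
  then show ?thesis
    by (simp add: transition_def affine_coords_def affine_param_def matrix_vector_mul_assoc[symmetric]
        matrix_vector_mult_scaleR)
qed

lemma affine_lift_transition:
  fixes A B :: "real^('n::finite option)^('n option)"
  defines "w \<equiv> \<lambda>x. matrix_inv B *v (A *v affine_lift x)"
  assumes "w x $ None > 0"
  shows "affine_lift (transition A B x) = w x /\<^sub>R (w x $ None)"
  unfolding vec_eq_iff
proof
  fix j
  have "transition A B x $ i = w x $ Some i / w x $ None" for i
    by (simp add: transition_nth w_def matrix_vector_mul_assoc)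
  then show "affine_lift (transition A B x) $ j = (w x /\<^sub>R (w x $ None)) $ j"
    using assms(2) by (cases j) (simp_all add: affine_lift_def field_simps)
qed

lemma affine_param_in_affine_dom_iff:
  fixes A B :: "real^('n::finite option)^('n option)"
  shows "affine_param A x \<in> affine_dom B \<longleftrightarrow> (matrix_inv B *v (A *v affine_lift x)) $ None > 0"
proof (cases "A *v affine_lift x = 0")
  case True
  then show ?thesis by (simp add: affine_dom_def affine_param_def)
next
  case False
  then show ?thesis
    by (simp add: affine_dom_def affine_param_def matrix_vector_mult_scaleR zero_less_mult_iff
        zero_less_divide_iff)
qed

lemma transition_inverse:
  fixes A B :: "real^('n::finite option)^('n option)"
  assumes inv: "invertible A" "invertible B" and dom: "affine_param A x \<in> affine_dom B"
  shows "affine_param B (transition A B x) \<in> affine_dom A" "transition B A (transition A B x) = x"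
proof -
  define w where "w = matrix_inv B *v (A *v affine_lift x)"
  have w: "w $ None > 0" using dom by (simp add: affine_param_in_affine_dom_iff w_def)
  have lift: "affine_lift (transition A B x) = w /\<^sub>R (w $ None)"
    using w affine_lift_transition[of B A x] by (simp add: w_def)
  have "B *v w = A *v affine_lift x"
    unfolding w_def by (simp add: matrix_vector_mul_assoc matrix_mul_assoc invertible_matrix_inv[OF inv(2)])
  then have "matrix_inv A *v (B *v w) = affine_lift x"
    by (simp only:) (simp add: matrix_vector_mul_assoc invertible_matrix_inv[OF inv(1)])
  then have inverse: "matrix_inv A *v (B *v affine_lift (transition A B x)) = affine_lift x /\<^sub>R (w $ None)"
    unfolding lift by (simp add: matrix_vector_mult_scaleR)
  have pos: "(matrix_inv A *v (B *v affine_lift (transition A B x))) $ None > 0"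
    unfolding inverse using w by (simp add: affine_lift_def)
  then show "affine_param B (transition A B x) \<in> affine_dom A"
    by (simp add: affine_param_in_affine_dom_iff)
  have "affine_lift (transition B A (transition A B x)) = affine_lift x"
    using w affine_lift_transition[OF pos] unfolding inverse by (simp add: affine_lift_def)
  then have "affine_lift (transition B A (transition A B x)) $ Some i = affine_lift x $ Some i" for i
    by simp
  then show "transition B A (transition A B x) = x"
    by (simp add: affine_lift_def vec_eq_iff)
qed

lemma differentiable_vecI:
  fixes f :: "'a::real_normed_vector \<Rightarrow> real^'m::finite"
  assumes "\<And>i. (\<lambda>x. f x $ i) differentiable (at x)"
  shows "f differentiable (at x)"
  using assms
  by (subst differentiable_componentwise_within) (auto simp: Basis_vec_def inner_axis)

lemma differentiable_affine_lift: "affine_lift differentiable (at x)"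
proof (rule differentiable_vecI)
  fix i :: "'a option"
  show "(\<lambda>x. affine_lift x $ i) differentiable (at x)"
    by (cases i) (auto simp: affine_lift_def
        intro!: bounded_linear_imp_differentiable bounded_linear_vec_nth)
qed

lemma differentiable_matrix_affine_lift_component:
  fixes C :: "real^('n::finite option)^'m::finite"
  shows "(\<lambda>x. (C *v affine_lift x) $ i) differentiable (at x)"
proof -
  have "bounded_linear (\<lambda>v. (C *v v) $ i)"
    by (intro bounded_linear_compose[OF bounded_linear_vec_nth] matrix_vector_mul_bounded_linear)
  from differentiable_chain_at[OF differentiable_affine_lift bounded_linear_imp_differentiable[OF this]]
  show ?thesis by (simp add: o_def)
qed

lemma differentiable_transition:
  assumes "affine_param A x \<in> affine_dom B"
  shows "transition A B differentiable (at x)"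
proof (rule differentiable_vecI)
  fix i
  show "(\<lambda>x. transition A B x $ i) differentiable (at x)"
    unfolding transition_nth
    by (intro differentiable_divide differentiable_matrix_affine_lift_component)
      (use assms in \<open>auto simp: affine_param_in_affine_dom_iff matrix_vector_mul_assoc\<close>)
qed

text \<open>
  The chain rule for the two mutually inverse coordinate changes, which compose to the
  identity on an open neighbourhood.  It guarantees that every covector in one chart
  comes from a covector in the other.
\<close>

lemma jacobian_transition_left_inverse:
  fixes A B :: "real^('n::finite option)^('n option)"
  assumes inv: "invertible A" "invertible B" and dom: "affine_param A x \<in> affine_dom B"
  shows "jacobian (transition B A) (at (transition A B x)) ** jacobian (transition A B) (at x) = mat 1"
    (is "?K ** ?J = _")
proof -
  define U where "U = {z. affine_param A z \<in> affine_dom B}"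
  have "continuous_on UNIV (\<lambda>z. ((matrix_inv B ** A) *v affine_lift z) $ None)"
    by (intro continuous_at_imp_continuous_on ballI differentiable_imp_continuous_within
        differentiable_matrix_affine_lift_component)
  then have "open U"
    unfolding U_def affine_param_in_affine_dom_iff matrix_vector_mul_assoc
    by (intro open_Collect_less continuous_on_const)
  have "(transition A B has_derivative (\<lambda>h. ?J *v h)) (at x)"
    using differentiable_transition[OF dom] by (simp add: jacobian_works)
  moreover have "(transition B A has_derivative (\<lambda>h. ?K *v h)) (at (transition A B x))"
    using differentiable_transition[OF transition_inverse(1)[OF assms]] by (simp add: jacobian_works)
  ultimately have "(transition B A \<circ> transition A B has_derivative (\<lambda>h. ?K *v h) \<circ> (\<lambda>h. ?J *v h)) (at x)"
    by (rule diff_chain_at)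
  moreover have "(transition B A \<circ> transition A B has_derivative (\<lambda>h. h)) (at x)"
    by (rule has_derivative_transform_within_open[OF has_derivative_ident \<open>open U\<close>])
      (use dom in \<open>auto simp: U_def transition_inverse[OF inv]\<close>)
  ultimately have "(\<lambda>h. ?K *v h) \<circ> (\<lambda>h. ?J *v h) = (\<lambda>h. h)"
    by (rule has_derivative_unique)
  then have "(?K ** ?J) *v h = mat 1 *v h" for h
    by (simp add: o_def fun_eq_iff matrix_vector_mul_assoc)
  then show ?thesis by (simp add: matrix_eq)
qed

text \<open>
  The open hemispheres around the positive and negative coordinate axes: a unit vector has a nonzero
  coordinate \<open>c\<close>, of sign \<open>s\<close>.  The frame \<open>B (c, s)\<close> below exchanges the axes \<open>None\<close> and \<open>c\<close>
  and multiplies by \<open>s\<close>; it is its own inverse.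
\<close>

lemma finite_affine_cover:
  "\<exists>\<B>. finite \<B> \<and> (\<forall>B\<in>\<B>. invertible B)
    \<and> (\<forall>u \<in> sphere (0 :: real^('n::finite option)) 1. \<exists>B\<in>\<B>. u \<in> affine_dom B)"
proof -
  define t where "t c j = (if j = None then c else if j = c then None else j)" for c j :: "'n option"
  have tt: "t c (t c j) = j" for c j by (auto simp: t_def)
  define B :: "'n option \<times> real \<Rightarrow> real^('n option)^('n option)"
    where "B = (\<lambda>(c, s). \<chi> i j. if j = t c i then s else 0)"
  have B: "(B (c, s) *v u) $ i = s * u $ t c i" for c s u i
    by (simp add: B_def matrix_vector_mult_def if_distrib[of "\<lambda>z. z * _"] cong: if_cong)
  have BB: "B (c, s) ** B (c, s) = mat 1" if "s * s = 1" for c s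
    unfolding matrix_eq matrix_vector_mul_assoc[symmetric]
    using that by (simp add: vec_eq_iff B tt mult.assoc[symmetric])
  have invB: "invertible (B (c, s))" if "s * s = 1" for c s
    using BB[OF that] by (auto simp: invertible_def)
  have mB: "matrix_inv (B (c, s)) = B (c, s)" if "s * s = 1" for c s
  proof -
    have "matrix_inv (B (c, s)) = matrix_inv (B (c, s)) ** (B (c, s) ** B (c, s))"
      by (simp add: BB[OF that])
    also have "\<dots> = B (c, s)"
      unfolding matrix_mul_assoc invertible_matrix_inv[OF invB[OF that]] by simp
    finally show ?thesis .
  qed
  show ?thesis
  proof (intro exI[of _ "B ` (UNIV \<times> {1, -1})"] conjI ballI)
    show "finite (B ` (UNIV \<times> {1, -1}))" by simp
    show "invertible b" if "b \<in> B ` (UNIV \<times> {1, -1})" for b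
      using that invB by auto
    fix u :: "real^('n option)" assume u: "u \<in> sphere 0 1"
    then have "u \<noteq> 0" by auto
    then obtain c where c: "u $ c \<noteq> 0" by (auto simp: vec_eq_iff)
    define s :: real where "s = sgn (u $ c)"
    have s: "s \<in> {1, -1}" "s * s = 1" "s * u $ c > 0"
      using c by (auto simp: s_def sgn_if)
    have "t c None = c" by (simp add: t_def)
    then have "u \<in> affine_dom (B (c, s))"
      using u s by (simp add: affine_dom_def mB B)
    with s(1) show "\<exists>b\<in>B ` (UNIV \<times> {1, -1}). u \<in> affine_dom b" by blast
  qed
qed

section \<open>Homogeneous components of a symbol\<close>

lemma ray_poly_fibre_poly:
  assumes "\<And>k. h k \<in> homogeneous_poly k"
  shows "ray_poly (\<lambda>x \<xi>. \<Sum>k\<le>N. h k x \<xi>) x \<xi> = (\<Sum>k\<le>N. monom (h k x \<xi>) k)"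
  by (rule ray_poly_sum) (rule assms)

lemma poly_ray_poly:
  assumes "p \<in> fibre_poly"
  shows "poly (ray_poly p x \<xi>) (of_real t) = p x (t *\<^sub>R \<xi>)"
proof -
  obtain N h where h: "\<And>k. h k \<in> homogeneous_poly k" "p = (\<lambda>x \<xi>. \<Sum>k\<le>N. h k x \<xi>)"
    using assms by (rule fibre_polyE) blast
  show ?thesis
    unfolding h(2) ray_poly_fibre_poly[of h, OF h(1)]
    by (simp add: poly_sum poly_monom homogeneous_poly_scaleR[OF h(1)] mult.commute)
qed

lemma degree_ray_poly_bounded:
  assumes "p \<in> fibre_poly"
  shows "\<exists>N. \<forall>x \<xi>. degree (ray_poly p x \<xi>) \<le> N"
proof -
  obtain N h where h: "\<And>k. h k \<in> homogeneous_poly k" "p = (\<lambda>x \<xi>. \<Sum>k\<le>N. h k x \<xi>)"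
    using assms by (rule fibre_polyE) blast
  have "degree (ray_poly p x \<xi>) \<le> N" for x \<xi>
    unfolding h(2) ray_poly_fibre_poly[of h, OF h(1)]
    by (intro degree_sum_le) (auto intro: order_trans[OF degree_monom_le])
  then show ?thesis by blast
qed

lemma coeff_ray_poly_homogeneous:
  assumes "p \<in> fibre_poly"
  shows "(\<lambda>x \<xi>. coeff (ray_poly p x \<xi>) k) \<in> homogeneous_poly k"
proof -
  obtain N h where h: "\<And>k. h k \<in> homogeneous_poly k" "p = (\<lambda>x \<xi>. \<Sum>k\<le>N. h k x \<xi>)"
    using assms by (rule fibre_polyE) blast
  have "coeff (ray_poly p x \<xi>) k = (if k \<le> N then h k x \<xi> else 0)" for x \<xi>
    unfolding h(2) ray_poly_fibre_poly[of h, OF h(1)] by (simp add: coeff_sum)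
  then show ?thesis
    by (cases "k \<le> N") (simp_all add: h(1) zero_homogeneous_poly)
qed

definition component :: "nat \<Rightarrow> ('n::finite) symbol \<Rightarrow> 'n symbol"
  where "component k P A x \<xi> = coeff (ray_poly (P A) x \<xi>) k"

text \<open>
  The transformation law of symbols is linear in the covector, hence it holds along whole rays
  and therefore for each coefficient in the fibre degree separately.
\<close>

lemma ray_poly_transform:
  fixes P :: "('n::finite) symbol"
  assumes P: "P \<in> symbols \<delta>"
    and "invertible A" "invertible B" "affine_param A x \<in> affine_dom B"
  shows "ray_poly (P A) x (transpose (jacobian (transition A B) (at x)) *v \<eta>)
    = smult (of_real (\<bar>det (jacobian (transition A B) (at x))\<bar> powr \<delta>))
        (ray_poly (P B) (transition A B x) \<eta>)"
proof (rule ray_poly_eqI)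
  fix t :: real
  have "P B \<in> fibre_poly" using assms by (auto simp: symbols_def)
  moreover have "P A x (transpose (jacobian (transition A B) (at x)) *v (t *\<^sub>R \<eta>))
      = of_real (\<bar>det (jacobian (transition A B) (at x))\<bar> powr \<delta>) * P B (transition A B x) (t *\<^sub>R \<eta>)"
    using assms unfolding symbols_def by blast
  ultimately show "poly (smult (of_real (\<bar>det (jacobian (transition A B) (at x))\<bar> powr \<delta>))
        (ray_poly (P B) (transition A B x) \<eta>)) (of_real t)
      = P A x (t *\<^sub>R (transpose (jacobian (transition A B) (at x)) *v \<eta>))"
    by (simp add: poly_ray_poly matrix_vector_mult_scaleR)
qed

text \<open>
  Weights \<open>a\<close> cover with one argument both a single component and the partial sums of components.
\<close>

lemma weighted_components_symbol:
  fixes P :: "('n::finite) symbol"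
  assumes P: "P \<in> symbols \<delta>"
  shows "(\<lambda>A x \<xi>. \<Sum>k\<le>N. a k * component k P A x \<xi>) \<in> symbols \<delta>"
  unfolding symbols_def
proof (intro CollectI conjI allI impI)
  fix A :: "real^('n option)^('n option)"
  assume "\<not> invertible A"
  then have "P A = (\<lambda>x \<xi>. 0)" using P by (simp add: symbols_def)
  then have "ray_poly (P A) x \<xi> = 0" for x \<xi> by (intro ray_poly_eqI) simp
  then show "(\<lambda>x \<xi>. \<Sum>k\<le>N. a k * component k P A x \<xi>) = (\<lambda>x \<xi>. 0)"
    by (simp add: component_def)
next
  fix A :: "real^('n option)^('n option)"
  assume "invertible A"
  then have "P A \<in> fibre_poly" using P by (simp add: symbols_def)
  then have "(\<lambda>x \<xi>. \<Sum>s\<in>{()}. a k * component k P A x \<xi>) \<in> homogeneous_poly k" for k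
    unfolding component_def by (intro homogeneous_poly_lincomb coeff_ray_poly_homogeneous) auto
  then show "(\<lambda>x \<xi>. \<Sum>k\<le>N. a k * component k P A x \<xi>) \<in> fibre_poly"
    unfolding fibre_poly_def
    by (intro CollectI exI[of _ N] exI[of _ "\<lambda>k x \<xi>. a k * component k P A x \<xi>"]) auto
next
  fix A B :: "real^('n option)^('n option)" and x \<eta>
  assume "invertible A" "invertible B" "affine_param A x \<in> affine_dom B"
  then show "(\<Sum>k\<le>N. a k * component k P A x (transpose (jacobian (transition A B) (at x)) *v \<eta>))
      = of_real (\<bar>det (jacobian (transition A B) (at x))\<bar> powr \<delta>)
        * (\<Sum>k\<le>N. a k * component k P B (transition A B x) \<eta>)"
    by (simp add: component_def ray_poly_transform[OF P] sum_distrib_left mult.left_commute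
        del: transpose_matrix_vector)
qed

lemma component_homogeneous_symbol:
  fixes P :: "('n::finite) symbol"
  assumes P: "P \<in> symbols \<delta>"
  shows "component k P \<in> homogeneous_symbols k \<delta>"
proof -
  have "component k P = (\<lambda>A x \<xi>. \<Sum>j\<le>k. (if j = k then 1 else 0) * component j P A x \<xi>)"
    by (simp add: fun_eq_iff if_distrib[of "\<lambda>z. z * _"] cong: if_cong)
  then have "component k P \<in> symbols \<delta>"
    using weighted_components_symbol[OF P, where N = k and a = "\<lambda>j. if j = k then 1 else 0"] by simp
  moreover have "component k P A \<in> homogeneous_poly k" if "invertible A" for A
    using coeff_ray_poly_homogeneous[of "P A" k] P that
    by (simp add: component_def[abs_def] symbols_def)
  ultimately show ?thesis by (simp add: homogeneous_symbols_def)
qed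

text \<open>
  In each chart of a finite cover the degree is bounded by the definition of a symbol.  A point of
  any other chart lies in one of these, and the invertible linear action on covectors preserves
  the degree.
\<close>

lemma symbol_degree_bounded:
  fixes P :: "('n::finite) symbol"
  assumes P: "P \<in> symbols \<delta>"
  shows "\<exists>M. \<forall>A x \<xi>. invertible A \<longrightarrow> degree (ray_poly (P A) x \<xi>) \<le> M"
proof -
  obtain \<B> where fin: "finite \<B>" and inv: "\<And>B. B \<in> \<B> \<Longrightarrow> invertible B"
    and cover: "\<And>u :: real^('n option). u \<in> sphere 0 1 \<Longrightarrow> \<exists>B\<in>\<B>. u \<in> affine_dom B"
    using finite_affine_cover by blast
  have "\<forall>B\<in>\<B>. \<exists>N. \<forall>x \<xi>. degree (ray_poly (P B) x \<xi>) \<le> N"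
    using P inv by (auto simp: symbols_def intro!: degree_ray_poly_bounded)
  then obtain N where N: "\<And>B x \<xi>. B \<in> \<B> \<Longrightarrow> degree (ray_poly (P B) x \<xi>) \<le> N B" by metis
  have "degree (ray_poly (P A) x \<xi>) \<le> Max (N ` \<B>)" if A: "invertible A" for A x \<xi>
  proof -
    have "affine_lift x \<noteq> 0" by (auto simp: affine_lift_def vec_eq_iff split: option.splits)
    moreover have "affine_lift x = matrix_inv A *v (A *v affine_lift x)"
      by (simp add: matrix_vector_mul_assoc invertible_matrix_inv[OF A])
    ultimately have "A *v affine_lift x \<noteq> 0" by force
    then have "affine_param A x \<in> sphere 0 1" by (simp add: affine_param_def)
    with cover obtain B where B: "B \<in> \<B>" "affine_param A x \<in> affine_dom B" by blast
    define J where "J = jacobian (transition A B) (at x)"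
    define K where "K = jacobian (transition B A) (at (transition A B x))"
    have "K ** J = mat 1"
      unfolding J_def K_def by (rule jacobian_transition_left_inverse[OF A inv[OF B(1)] B(2)])
    then have "transpose J ** transpose K = mat 1"
      by (simp add: matrix_transpose_mul[symmetric] transpose_mat)
    then have "\<xi> = transpose J *v (transpose K *v \<xi>)"
      by (simp add: matrix_vector_mul_assoc del: transpose_matrix_vector)
    then have "ray_poly (P A) x \<xi> = smult (of_real (\<bar>det J\<bar> powr \<delta>))
        (ray_poly (P B) (transition A B x) (transpose K *v \<xi>))"
      using ray_poly_transform[OF P A inv[OF B(1)] B(2), of "transpose K *v \<xi>"]
      by (simp add: J_def del: transpose_matrix_vector)
    then have "degree (ray_poly (P A) x \<xi>) \<le> N B"
      using N[OF B(1)] by (metis degree_smult_le order_trans)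
    also have "\<dots> \<le> Max (N ` \<B>)" using fin B(1) by simp
    finally show ?thesis .
  qed
  then show ?thesis by blast
qed

lemma symbol_eq_sum_components:
  fixes P :: "('n::finite) symbol"
  assumes P: "P \<in> symbols \<delta>"
  obtains M where "P = (\<lambda>A x \<xi>. \<Sum>k\<le>M. component k P A x \<xi>)"
proof -
  obtain M where M: "\<And>A x \<xi>. invertible A \<Longrightarrow> degree (ray_poly (P A) x \<xi>) \<le> M"
    using symbol_degree_bounded[OF P] by blast
  have "P A x \<xi> = (\<Sum>k\<le>M. component k P A x \<xi>)" for A x \<xi>
  proof (cases "invertible A")
    case True
    then have "P A \<in> fibre_poly" using P by (simp add: symbols_def)
    then have "P A x \<xi> = poly (ray_poly (P A) x \<xi>) 1"
      using poly_ray_poly[of "P A" x \<xi> 1] by simp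
    also have "\<dots> = (\<Sum>k\<le>degree (ray_poly (P A) x \<xi>). coeff (ray_poly (P A) x \<xi>) k)"
      by (simp add: poly_altdef)
    also have "\<dots> = (\<Sum>k\<le>M. coeff (ray_poly (P A) x \<xi>) k)"
      using M[OF True] by (intro sum.mono_neutral_left) (auto simp: coeff_eq_0)
    finally show ?thesis by (simp add: component_def)
  next
    case False
    then have "P A = (\<lambda>x \<xi>. 0)" using P by (simp add: symbols_def)
    moreover from this have "ray_poly (P A) x \<xi> = 0" by (intro ray_poly_eqI) simp
    ultimately show ?thesis by (simp add: component_def)
  qed
  then show ?thesis using that[of M] by (simp add: fun_eq_iff)
qed

lemma quantization_sum_components:
  fixes P :: "('n::finite) symbol"
  assumes Q: "equivariant_quantization hbar lam mu Q" and P: "P \<in> symbols (mu - lam)"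
    and \<phi>: "\<phi> \<in> densities lam"
  shows "Q (\<lambda>A x \<xi>. \<Sum>k\<le>N. component k P A x \<xi>) \<phi> A x = (\<Sum>k\<le>N. Q (component k P) \<phi> A x)"
proof (induction N)
  case 0
  show ?case by simp
next
  case (Suc N)
  define R :: "'n symbol" where "R = (\<lambda>A x \<xi>. \<Sum>k\<le>N. component k P A x \<xi>)"
  have "R \<in> symbols (mu - lam)"
    using weighted_components_symbol[OF P, where N = N and a = "\<lambda>_. 1"] by (simp add: R_def)
  moreover have "component (Suc N) P \<in> symbols (mu - lam)"
    using component_homogeneous_symbol[OF P] by (simp add: homogeneous_symbols_def)
  ultimately have "Q (\<lambda>A x \<xi>. 1 * R A x \<xi> + 1 * component (Suc N) P A x \<xi>) \<phi> A x
      = 1 * Q R \<phi> A x + 1 * Q (component (Suc N) P) \<phi> A x"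
    using Q \<phi> unfolding equivariant_quantization_def by blast
  then show ?case by (simp add: R_def Suc)
qed

section \<open>The hypergeometric form\<close>

text \<open>
  The \<open>m\<close>-th term of the series at the component of degree \<open>k\<close> is the known term for \<open>m \<le> k\<close>
  and vanishes for \<open>m > k\<close>, where the divergence has been applied more often than the degree permits.
\<close>

lemma hypergeometric_sums_components:
  fixes q :: "nat \<Rightarrow> real^'n::finite \<Rightarrow> real^'n \<Rightarrow> complex"
  assumes q: "\<And>k. q k \<in> homogeneous_poly k" and nonres: "\<And>l::nat. d * (1 - \<delta>) \<noteq> - real l"
  shows "hypergeometric_sums
      (\<lambda>e. e + d * lam)
      (\<lambda>e. 2 * e + d * (1 - \<delta>) - 1)
      (\<lambda>e. e + 1/2 * d * (1 - \<delta>) - 1/2)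
      (\<lambda>e. e + 1/2 * d * (1 - \<delta>))
      (\<lambda>p x \<xi>. \<i> * of_real hbar / 4 * divergence p x \<xi>)
      (\<lambda>x \<xi>. \<Sum>k\<le>M. q k x \<xi>)
      (\<lambda>x \<xi>. \<Sum>k\<le>M. \<Sum>m\<le>k. of_real (quant_coeff d lam \<delta> k m)
             * (\<i> * of_real hbar) ^ m * (divergence ^^ m) (q k) x \<xi>)"
  unfolding hypergeometric_sums_def
proof (intro allI)
  fix x \<xi> :: "real^'n"
  define z :: complex where "z = \<i> * of_real hbar / 4"
  define c where "c m e = pochhammer (e + d * lam) m
    * poch_quotient (2 * e + d * (1 - \<delta>) - 1) (e + 1/2 * d * (1 - \<delta>) - 1/2)
        (e + 1/2 * d * (1 - \<delta>)) m" for m e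
  define g where "g k m = of_real (quant_coeff d lam \<delta> k m)
    * (\<i> * of_real hbar) ^ m * (divergence ^^ m) (q k) x \<xi>" for k m
  have "coeff_of_degree_op (c m) (((\<lambda>p x \<xi>. z * divergence p x \<xi>) ^^ m) (\<lambda>x \<xi>. \<Sum>k\<le>M. q k x \<xi>)) x \<xi>
      / fact m = (\<Sum>k\<le>M. if m \<in> {..k} then g k m else 0)" for m
  proof -
    \<comment> \<open>A sum over a singleton presents the scalar multiple as a linear combination.\<close>
    have h: "(\<lambda>x \<xi>. \<Sum>s\<in>{()}. z ^ m * (divergence ^^ m) (q k) x \<xi>) \<in> homogeneous_poly (k - m)" for k
      by (intro homogeneous_poly_lincomb divergence_power_homogeneous q) simp
    have "((\<lambda>p x \<xi>. z * divergence p x \<xi>) ^^ m) (\<lambda>x \<xi>. \<Sum>k\<le>M. q k x \<xi>)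
        = (\<lambda>x \<xi>. \<Sum>k\<le>M. z ^ m * (divergence ^^ m) (q k) x \<xi>)"
      by (rule scaled_divergence_power[where d = "\<lambda>k. k"]) (auto intro: q)
    then have "coeff_of_degree_op (c m) (((\<lambda>p x \<xi>. z * divergence p x \<xi>) ^^ m) (\<lambda>x \<xi>. \<Sum>k\<le>M. q k x \<xi>)) x \<xi>
        = (\<Sum>k\<le>M. of_real (c m (real (k - m))) * (z ^ m * (divergence ^^ m) (q k) x \<xi>))"
      using coeff_of_degree_op_sum[of "{..M}" "\<lambda>k x \<xi>. z ^ m * (divergence ^^ m) (q k) x \<xi>" "\<lambda>k. k - m"] h
      by simp
    also have "\<dots> / fact m = (\<Sum>k\<le>M. if m \<in> {..k} then g k m else 0)"
      unfolding sum_divide_distrib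
    proof (intro sum.cong refl)
      fix k
      show "of_real (c m (real (k - m))) * (z ^ m * (divergence ^^ m) (q k) x \<xi>) / fact m
          = (if m \<in> {..k} then g k m else 0)"
      proof (cases "m \<le> k")
        case True
        have "c m (real (k - m)) / fact m = 4 ^ m * quant_coeff d lam \<delta> k m"
          unfolding c_def by (rule quant_coeff_hypergeometric[OF nonres True])
        then have "complex_of_real (c m (real (k - m)) / fact m) * z ^ m
            = of_real (quant_coeff d lam \<delta> k m) * (\<i> * of_real hbar) ^ m"
          by (simp add: z_def power_divide)
        then have "of_real (c m (real (k - m))) * z ^ m / fact m
            = of_real (quant_coeff d lam \<delta> k m) * (\<i> * of_real hbar) ^ m"
          by simp
        with True show ?thesis
          by (simp add: g_def mult.assoc[symmetric]) (simp add: divide_simps)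
      next
        case False
        then show ?thesis using divergence_power_vanishes[OF q, of k m] by simp
      qed
    qed
    finally show ?thesis .
  qed
  moreover have "(\<lambda>m. \<Sum>k\<le>M. if m \<in> {..k} then g k m else 0) sums (\<Sum>k\<le>M. \<Sum>m\<in>{..k}. g k m)"
    by (intro sums_sum sums_If_finite_set) simp
  ultimately show "(\<lambda>m. coeff_of_degree_op
      (\<lambda>e. pochhammer (e + d * lam) m
        * poch_quotient (2 * e + d * (1 - \<delta>) - 1) (e + 1/2 * d * (1 - \<delta>) - 1/2)
            (e + 1/2 * d * (1 - \<delta>)) m)
      (((\<lambda>p x \<xi>. \<i> * of_real hbar / 4 * divergence p x \<xi>) ^^ m) (\<lambda>x \<xi>. \<Sum>k\<le>M. q k x \<xi>)) x \<xi> / fact m)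
    sums (\<Sum>k\<le>M. \<Sum>m\<le>k. of_real (quant_coeff d lam \<delta> k m)
             * (\<i> * of_real hbar) ^ m * (divergence ^^ m) (q k) x \<xi>)"
    unfolding c_def z_def g_def by simp
qed

theorem theorem3p1:
  fixes lam mu \<delta> hbar n :: real
    and Q :: "('n::finite) symbol \<Rightarrow> 'n density \<Rightarrow> 'n density"
    and P :: "'n symbol"
    and A :: "real^('n option)^('n option)"
  assumes "n = real CARD('n)"
    and "\<delta> = mu - lam"
    and "hbar > 0"
    and "\<And>l::nat. \<delta> \<noteq> 1 + real l / (n + 1)"
    and "equivariant_quantization hbar lam mu Q"
    and "known_affine_formula hbar lam mu Q"
    and "P \<in> symbols \<delta>"
    and "invertible A"
  shows "\<exists>\<sigma>. identified_with hbar lam A (Q P) \<sigma> \<and>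
    hypergeometric_sums
      (\<lambda>e. e + (n + 1) * lam)
      (\<lambda>e. 2 * e + (n + 1) * (1 - \<delta>) - 1)
      (\<lambda>e. e + 1/2 * (n + 1) * (1 - \<delta>) - 1/2)
      (\<lambda>e. e + 1/2 * (n + 1) * (1 - \<delta>))
      (\<lambda>p x \<xi>. \<i> * of_real hbar / 4 * divergence p x \<xi>)
      (P A) \<sigma>"
proof -
  have d: "n + 1 = real CARD('n) + 1" and pos: "n + 1 > 0" using assms(1) by simp_all
  have P: "P \<in> symbols (mu - lam)" using assms(2,7) by simp
  obtain M where M: "P = (\<lambda>A x \<xi>. \<Sum>k\<le>M. component k P A x \<xi>)"
    using symbol_eq_sum_components[OF P] .
  define \<sigma> where "\<sigma> = (\<lambda>x \<xi>. \<Sum>k\<le>M. \<Sum>m\<le>k. of_real (quant_coeff (n + 1) lam \<delta> k m)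
    * (\<i> * of_real hbar) ^ m * (divergence ^^ m) (component k P A) x \<xi>)"
  have "identified_with hbar lam A (Q P) \<sigma>"
    unfolding \<sigma>_def
  proof (rule identified_with_sum[where T = "\<lambda>k. Q (component k P)"])
    show "identified_with hbar lam A (Q (component k P)) (\<lambda>x \<xi>. \<Sum>m\<le>k.
        of_real (quant_coeff (n + 1) lam \<delta> k m)
          * (\<i> * of_real hbar) ^ m * (divergence ^^ m) (component k P A) x \<xi>)" for k
      using assms(6,8) component_homogeneous_symbol[OF P, of k]
      unfolding known_affine_formula_def d assms(2) by blast
    show "Q P \<phi> A x = (\<Sum>k\<le>M. Q (component k P) \<phi> A x)" if "\<phi> \<in> densities lam" for \<phi> x
      using quantization_sum_components[OF assms(5) P that, of M A x] M by simp
  qed simp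
  moreover have "(n + 1) * (1 - \<delta>) \<noteq> - real l" for l
    using assms(4)[of l] pos by (auto simp: field_simps)
  then have "hypergeometric_sums
      (\<lambda>e. e + (n + 1) * lam)
      (\<lambda>e. 2 * e + (n + 1) * (1 - \<delta>) - 1)
      (\<lambda>e. e + 1/2 * (n + 1) * (1 - \<delta>) - 1/2)
      (\<lambda>e. e + 1/2 * (n + 1) * (1 - \<delta>))
      (\<lambda>p x \<xi>. \<i> * of_real hbar / 4 * divergence p x \<xi>)
      (\<lambda>x \<xi>. \<Sum>k\<le>M. component k P A x \<xi>) \<sigma>"
    unfolding \<sigma>_def using component_homogeneous_symbol[OF P] assms(8)
    by (intro hypergeometric_sums_components) (auto simp: homogeneous_symbols_def)
  moreover have "P A = (\<lambda>x \<xi>. \<Sum>k\<le>M. component k P A x \<xi>)"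
    by (rule fun_cong[OF M])
  ultimately show ?thesis by auto
qed

end
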